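(* Let $p,q$ be positive integers with $p\geq q$ and $p\geq 2$, and let $\mathcal{L}$ denote the equation $px+qy=z$. Then $$f_{\max}(n,\mathcal{L})\leq 2^{\mu_{\mathcal{L}}(\lfloor \frac{n-p}{q}\rfloor)+o(n)}.$$ Further, if $q\geq 2$ and $p>q(3q-2)/(2q-2)$, or $q=1$ and $p\geq 3$, then $$f_{\max}(n,\mathcal{L})=O\left(2^{\mu_{\mathcal{L}}(\lfloor \frac{n-p}{q}\rfloor)}\right).$$
   Context: $[n]=\{1,\dots,n\}$. A set $A\subseteq[n]$ is $\mathcal{L}$-free, for $\mathcal{L}$ the equation $px+qy=z$ with $p,q$ as in the statement, if there are no $x,y,z\in A$ (not necessarily distinct) with $px+qy=z$ (such an equation has no trivial solutions). A set $S\subseteq[n]$ is a maximal $\mathcal{L}$-free subset of $[n]$ if it is $\mathcal{L}$-free and not properly contained in another $\mathcal{L}$-free subset of $[n]$; $f_{\max}(n,\mathcal{L})$ is the number of these. $\mu_{\mathcal{L}}(N)$ is the size of the largest $\mathcal{L}$-free subset of $[N]$. Asymptotic notation is for $n\to\infty$ with $p,q$ fixed. *)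

theory Defs
  imports Complex_Main "HOL-Library.Landau_Symbols"
begin

text \<open>Throughout, the pair of coefficients \<open>p\<close>, \<open>q\<close> represents the equation
  \<open>p x + q y = z\<close>, and \<open>[n]\<close> is rendered as \<open>{1..n}\<close>.\<close>

text \<open>The witnesses \<open>x\<close>, \<open>y\<close>, \<open>z\<close> need not be distinct.\<close>

definition L_free :: "nat \<Rightarrow> nat \<Rightarrow> nat set \<Rightarrow> bool" where
  "L_free p q A \<longleftrightarrow> \<not> (\<exists>x\<in>A. \<exists>y\<in>A. \<exists>z\<in>A. p * x + q * y = z)"

definition maximal_L_free :: "nat \<Rightarrow> nat \<Rightarrow> nat \<Rightarrow> nat set \<Rightarrow> bool" where
  "maximal_L_free p q n S \<longleftrightarrow>
     S \<subseteq> {1..n} \<and> L_free p q S \<and> \<not> (\<exists>T. T \<subseteq> {1..n} \<and> L_free p q T \<and> S \<subset> T)"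

definition f_max :: "nat \<Rightarrow> nat \<Rightarrow> nat \<Rightarrow> nat" where
  "f_max p q n = card {S. maximal_L_free p q n S}"

definition mu_L :: "nat \<Rightarrow> nat \<Rightarrow> nat \<Rightarrow> nat" where
  "mu_L p q N = Max (card ` {A. A \<subseteq> {1..N} \<and> L_free p q A})"

end

theory Submission
  imports Defs "HOL-Real_Asymp.Real_Asymp"
begin

text \<open>Write \<open>k = p + q\<close> and \<open>N = (n - p) div q\<close>. Elements of \<open>[n]\<close> above \<open>N\<close> can only play the
  role of \<open>z\<close>, so a maximal \<open>L\<close>-free set is determined by its trace on \<open>[N]\<close>, and it suffices to
  count the \<open>L\<close>-free subsets \<open>T\<close> of \<open>[N]\<close>; the interval \<open>(N/k, N]\<close> bounds \<open>\<mu>\<close> from below.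
  If some short block below \<open>N/k\<close> contains a large bounded number of elements \<open>s \<in> T\<close>, then, beyond
  the first such block, \<open>T\<close> is independent in the graph \<open>y \<sim> q y + p s\<close> of large degree, and a
  branching argument bounds the number of such sets by \<open>2\<close> to the power \<open>(1 - 1/k + o(1)) N\<close>, with
  a linear gain if \<open>p > q\<close> and the block lies well below \<open>N/k\<close>. Otherwise \<open>T\<close> has boundedly many elements
  below about \<open>N/k\<close>, which gives the first claim. For the second claim, a single element \<open>m \<in> T\<close>
  with \<open>m \<le> N/k\<close> yields a matching: its edges \<open>y \<sim> q y + p m\<close> cost a factor decaying geometrically in
  \<open>N/k - m\<close> (this needs \<open>2 (3/4)\<^bsup>k/q\<^esup> < 1\<close>) when \<open>m\<close> is the minimum and close to \<open>N/k\<close>, and its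
  edges \<open>x \<sim> p x + q m\<close> just above \<open>N/k\<close> an exponential factor when \<open>m\<close> is smaller.\<close>

section \<open>Reduction to counting \<open>L\<close>-free subsets of \<open>[N]\<close>\<close>

definition L_free_subsets :: "nat \<Rightarrow> nat \<Rightarrow> nat \<Rightarrow> nat set set" where
  "L_free_subsets p q N = {T. T \<subseteq> {1..N} \<and> L_free p q T}"

lemma finite_L_free_subsets [simp]: "finite (L_free_subsets p q N)"
  unfolding L_free_subsets_def by (rule finite_subset[of _ "Pow {1..N}"]) auto

lemma L_freeD: "L_free p q T \<Longrightarrow> x \<in> T \<Longrightarrow> y \<in> T \<Longrightarrow> p * x + q * y \<notin> T"
  unfolding L_free_def by blast

text \<open>Replacing \<open>x\<close> by 1 bounds \<open>y\<close>. For \<open>x\<close>, the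
  hypothesis \<open>q \<le> p\<close> enters through \<open>p * x + q * y - (p + q * x) = (p - q) *
  (x - 1) + q * (y - 1)\<close>, which is nonnegative.\<close>

lemma solution_le:
  fixes p q :: nat
  assumes "1 \<le> q" "q \<le> p" "p \<le> n" "1 \<le> x" "1 \<le> y" "p * x + q * y \<le> n"
  shows "x \<le> (n - p) div q" "y \<le> (n - p) div q"
proof -
  have *: "v \<le> (n - p) div q" if "p + q * v \<le> n" for v
    using that assms(1) by (simp add: less_eq_div_iff_mult_less_eq mult.commute)
  have "p * 1 \<le> p * x" using assms by simp
  then show "y \<le> (n - p) div q" using assms by (intro *) linarith
  obtain c where c: "p = q + c" using assms(2) le_iff_add by blast
  have "q * 1 \<le> q * y" "c * 1 \<le> c * x" using assms by (simp_all only: mult_le_mono)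
  then have "p + q * x \<le> p * x + q * y" by (simp only: c add_mult_distrib)
  then show "x \<le> (n - p) div q" using assms by (intro *) linarith
qed

lemma maximal_L_free_extend:
  assumes "maximal_L_free p q n S" "z \<in> {1..n}" "z \<notin> S"
  shows "\<exists>x\<in>insert z S. \<exists>y\<in>insert z S. p * x + q * y \<in> insert z S"
proof -
  have "\<not> L_free p q (insert z S)"
    using assms unfolding maximal_L_free_def
    by (metis insert_subset psubsetI subset_insertI insertI1)
  then show ?thesis unfolding L_free_def by blast
qed

text \<open>A \<open>z\<close> in \<open>S\<close> but not in \<open>S'\<close> lies above
  \<open>(n - p) div q\<close>, and maximality of \<open>S'\<close> yields a solution in
  \<open>insert z S'\<close>. Its \<open>x\<close> and \<open>y\<close> are too small to be
  \<open>z\<close>, so they belong to the common trace and hence to \<open>S\<close>, and the sum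
  can only be \<open>z\<close>; this contradicts freeness of \<open>S\<close>.\<close>

lemma maximal_subset:
  assumes pq: "1 \<le> q" "q \<le> p" "p \<le> n"
    and S: "maximal_L_free p q n S" and S': "maximal_L_free p q n S'"
    and eq: "S \<inter> {1..(n - p) div q} = S' \<inter> {1..(n - p) div q}"
  shows "S \<subseteq> S'"
proof
  fix z assume z: "z \<in> S"
  have sub: "S \<subseteq> {1..n}" "S' \<subseteq> {1..n}" and free: "L_free p q S" "L_free p q S'"
    using S S' by (auto simp: maximal_L_free_def)
  show "z \<in> S'"
  proof (rule ccontr)
    assume zn: "z \<notin> S'"
    then have zbig: "\<not> z \<le> (n - p) div q" using z eq sub by fastforce
    have zi: "z \<in> {1..n}" using z sub by auto
    obtain x y where xy: "x \<in> insert z S'" "y \<in> insert z S'" "p * x + q * y \<in> insert z S'"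
      using maximal_L_free_extend[OF S' zi zn] by blast
    have "x \<in> {1..n}" "y \<in> {1..n}" "p * x + q * y \<in> {1..n}"
      using xy zi sub by auto
    then have le: "x \<le> (n - p) div q" "y \<le> (n - p) div q"
      using solution_le[OF pq, of x y] by auto
    then have m: "x \<in> S'" "y \<in> S'" using xy zbig by auto
    then have "p * x + q * y = z" using xy(3) L_freeD[OF free(2)] by blast
    moreover have "x \<in> S" "y \<in> S" using m le eq sub by fastforce+
    ultimately show False using L_freeD[OF free(1)] z by blast
  qed
qed

lemma f_max_le:
  assumes "1 \<le> q" "q \<le> p" "p \<le> n"
  shows "f_max p q n \<le> card (L_free_subsets p q ((n - p) div q))"
  unfolding f_max_def
proof (rule card_inj_on_le)
  let ?N = "(n - p) div q"
  show "inj_on (\<lambda>S. S \<inter> {1..?N}) {S. maximal_L_free p q n S}"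
    using maximal_subset[OF assms] by (intro inj_onI) (simp, metis subset_antisym)
  show "(\<lambda>S. S \<inter> {1..?N}) ` {S. maximal_L_free p q n S} \<subseteq> L_free_subsets p q ?N"
    by (auto simp: maximal_L_free_def L_free_subsets_def L_free_def)
qed simp

text \<open>The interval \<open>?A\<close> is \<open>L\<close>-free because its smallest possible
  sum, \<open>(p + q) * (N div (p + q) + 1)\<close>, already exceeds \<open>N\<close>.\<close>

lemma mu_L_ge:
  assumes "1 \<le> p + q"
  shows "N - N div (p + q) \<le> mu_L p q N"
proof -
  let ?A = "{N div (p + q) + 1..N}"
  have "N < p * x + q * y" if "x \<in> ?A" "y \<in> ?A" for x y
  proof -
    have "N < (p + q) * (N div (p + q) + 1)"
      using assms by (metis Suc_eq_plus1 dividend_less_times_div less_eq_Suc_le mult_Suc_right add.commute One_nat_def)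
    also have "\<dots> \<le> p * x + q * y" using that
      unfolding add_mult_distrib by (intro add_mono mult_le_mono2) auto
    finally show ?thesis .
  qed
  then have "L_free p q ?A" unfolding L_free_def by fastforce
  then have "card ?A \<le> mu_L p q N" unfolding mu_L_def
    by (intro Max_ge) (auto intro!: image_eqI[of _ _ ?A])
  then show ?thesis by simp
qed

section \<open>Counting independent sets\<close>

text \<open>A vertex of large out-degree is either left out, or it excludes all its out-neighbours;
  iterating this until no such vertex is left costs only the factor \<open>l ^ card V\<close>.\<close>

lemma card_independent_le:
  fixes l :: real and out :: "'a \<Rightarrow> 'a set"
  assumes "finite V" and l: "1 \<le> l" "l ^ e + 1 \<le> l ^ Suc e"
    and B: "\<And>C. C \<subseteq> V \<Longrightarrow> (\<forall>y\<in>C. card (out y \<inter> C) \<le> e) \<Longrightarrow> card C \<le> B"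
  shows "real (card {I. I \<subseteq> V \<and> (\<forall>y\<in>I. out y \<inter> I = {})}) \<le> 2 ^ B * l ^ card V"
  using assms(1) B
proof (induction V rule: finite_psubset_induct)
  case (psubset V)
  let ?ind = "\<lambda>V. {I. I \<subseteq> V \<and> (\<forall>y\<in>I. out y \<inter> I = {})}"
  have fin: "finite (?ind W)" if "W \<subseteq> V" for W
    by (rule finite_subset[of _ "Pow V"]) (use that psubset.hyps in auto)
  show ?case
  proof (cases "\<forall>y\<in>V. card (out y \<inter> V) \<le> e")
    case True
    then have "card V \<le> B" using psubset.prems by simp
    have "card (?ind V) \<le> card (Pow V)"
      using psubset.hyps by (intro card_mono) auto
    also have "\<dots> = 2 ^ card V" using psubset.hyps by (simp add: card_Pow)
    also have "\<dots> \<le> 2 ^ B" using \<open>card V \<le> B\<close> by simp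
    finally have "real (card (?ind V)) \<le> real (2 ^ B)" by (rule of_nat_mono)
    also have "\<dots> = 2 ^ B" by simp
    also have "\<dots> \<le> 2 ^ B * l ^ card V" using l by simp
    finally show ?thesis .
  next
    case False
    then obtain y where y: "y \<in> V" "e < card (out y \<inter> V)" by force
    have ne: "out y \<inter> V \<noteq> {}" using y by auto
    have c1: "card (V - {y}) = card V - 1" using y psubset.hyps by (simp add: card_Diff_singleton)
    have "card (V - out y) = card V - card (out y \<inter> V)"
      using psubset.hyps by (subst card_Diff_subset_Int) (auto simp: Int_commute)
    moreover have "card (out y \<inter> V) \<le> card V" using psubset.hyps by (intro card_mono) auto
    ultimately have c2: "card (V - out y) \<le> card V - Suc e" "Suc e \<le> card V" using y by linarith+
    have "?ind V \<subseteq> ?ind (V - {y}) \<union> ?ind (V - out y)" by blast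
    then have "card (?ind V) \<le> card (?ind (V - {y}) \<union> ?ind (V - out y))"
      using fin[of "V - {y}"] fin[of "V - out y"] by (intro card_mono) auto
    also have "\<dots> \<le> card (?ind (V - {y})) + card (?ind (V - out y))" by (rule card_Un_le)
    finally have "real (card (?ind V)) \<le> real (card (?ind (V - {y}))) + real (card (?ind (V - out y)))"
      by linarith
    also have "real (card (?ind (V - {y}))) \<le> 2 ^ B * l ^ card (V - {y})"
      using y by (intro psubset.IH psubset.prems) auto
    also have "real (card (?ind (V - out y))) \<le> 2 ^ B * l ^ card (V - out y)"
      using ne by (intro psubset.IH psubset.prems) auto
    also have "2 ^ B * l ^ card (V - out y) \<le> 2 ^ B * l ^ (card V - Suc e)"
      using l c2 by (intro mult_left_mono power_increasing) auto
    also have "2 ^ B * l ^ card (V - {y}) + 2 ^ B * l ^ (card V - Suc e)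
       = 2 ^ B * l ^ (card V - Suc e) * (l ^ e + 1)"
      using c1 c2 by (simp add: algebra_simps flip: power_add)
    \<comment> \<open>The assumption on \<open>l\<close> amounts to
      \<open>1 / l + 1 / l ^ Suc e \<le> 1\<close>, which makes the two-branch recurrence
      close.\<close>
    also have "\<dots> \<le> 2 ^ B * l ^ (card V - Suc e) * l ^ Suc e"
      using l by (intro mult_left_mono) auto
    also have "\<dots> = 2 ^ B * l ^ card V"
      using c2 by (simp add: mult.assoc del: power_Suc flip: power_add)
    finally show ?thesis by simp
  qed
qed

text \<open>The pairs \<open>{y, h y}\<close> with \<open>y\<close> in \<open>E\<close> are pairwise
  disjoint, and on each of them a counted set has one of three traces instead of four. Every edge of
  the matching therefore gains the factor \<open>3 / 4\<close>.\<close>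

lemma card_matching_avoiding_le:
  fixes h :: "'a \<Rightarrow> 'a"
  assumes "finite C" "E \<subseteq> C" "inj_on h E" "h ` E \<subseteq> C - E"
  shows "real (card {I. I \<subseteq> C \<and> (\<forall>y\<in>E. \<not> (y \<in> I \<and> h y \<in> I))}) \<le> 2 ^ card C * (3 / 4) ^ card E"
proof -
  have "finite E" using assms finite_subset by blast
  then show ?thesis using assms
  proof (induction E arbitrary: C)
    case empty
    have "{I. I \<subseteq> C} = Pow C" by auto
    then show ?case using empty by (simp add: card_Pow)
  next
    case (insert y E)
    let ?D = "C - {y, h y}"
    let ?F = "{I. I \<subseteq> C \<and> (\<forall>x\<in>insert y E. \<not> (x \<in> I \<and> h x \<in> I))}"
    let ?G = "{I. I \<subseteq> ?D \<and> (\<forall>x\<in>E. \<not> (x \<in> I \<and> h x \<in> I))}"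
    have fG: "finite ?G" by (rule finite_subset[of _ "Pow C"]) (use insert.prems in auto)
    have yh: "y \<in> C" "h y \<in> C" "y \<noteq> h y" using insert.prems by auto
    have "?F \<subseteq> (\<lambda>(A, I). A \<union> I) ` ({{}, {y}, {h y}} \<times> ?G)"
    proof
      fix I assume I: "I \<in> ?F"
      then have "I = (I \<inter> {y, h y}) \<union> (I - {y, h y})" "I - {y, h y} \<in> ?G"
        "I \<inter> {y, h y} \<in> {{}, {y}, {h y}}" by auto
      then show "I \<in> (\<lambda>(A, I). A \<union> I) ` ({{}, {y}, {h y}} \<times> ?G)"
        by (intro image_eqI[of _ _ "(I \<inter> {y, h y}, I - {y, h y})"]) auto
    qed
    then have "card ?F \<le> card ({{}, {y}, {h y}} \<times> ?G)"
      using fG by (intro surj_card_le) auto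
    also have "\<dots> \<le> 3 * card ?G"
      using card_insert_le_m1[of 3 "{{y}, {h y}}" "{}"] by (simp add: card_cartesian_product card_insert_if)
    finally have "real (card ?F) \<le> 3 * real (card ?G)" by linarith
    also have "real (card ?G) \<le> 2 ^ card ?D * (3 / 4) ^ card E"
      using insert.prems insert.hyps by (intro insert.IH) (auto simp: inj_on_def)
    finally have "real (card ?F) \<le> 3 * 2 ^ card ?D * (3 / 4) ^ card E" by simp
    moreover have "card C = card ?D + 2"
    proof -
      have "card {y, h y} = 2" using yh by simp
      moreover have "card {y, h y} \<le> card C" using insert.prems yh by (intro card_mono) auto
      ultimately show ?thesis using insert.prems yh by (subst card_Diff_subset) auto
    qed
    ultimately show ?case using insert.hyps by (simp add: power_add mult_ac)
  qed
qed

lemma card_Union_bound: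
  fixes X :: real
  assumes "finite P" "\<And>i. i \<in> P \<Longrightarrow> finite (F i)" "\<And>i. i \<in> P \<Longrightarrow> real (card (F i)) \<le> X"
    and "A \<subseteq> (\<Union>i\<in>P. F i)"
  shows "real (card A) \<le> real (card P) * X"
proof -
  have "card A \<le> card (\<Union>i\<in>P. F i)" using assms by (intro card_mono) auto
  also have "\<dots> \<le> (\<Sum>i\<in>P. card (F i))" using assms(1) by (rule card_UN_le)
  finally have "real (card A) \<le> real (\<Sum>i\<in>P. card (F i))" by (rule of_nat_mono)
  also have "\<dots> = (\<Sum>i\<in>P. real (card (F i)))" by simp
  also have "\<dots> \<le> real (card P) * X" using assms by (intro sum_bounded_above) auto
  finally show ?thesis .
qed

definition small_subsets :: "nat \<Rightarrow> nat \<Rightarrow> nat set set" where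
  "small_subsets N R = {P. P \<subseteq> {1..N} \<and> card P \<le> R}"

lemma finite_small_subsets [simp]: "finite (small_subsets N R)"
  unfolding small_subsets_def by (rule finite_subset[of _ "Pow {1..N}"]) auto

text \<open>Such a set is listed by a word of length \<open>R\<close> over \<open>{0..N}\<close>,
  padded with 0; the padding can be removed again because 0 is outside
  \<open>{1..N}\<close>.\<close>

lemma card_small_subsets: "card (small_subsets N R) \<le> (N + 1) ^ R"
proof -
  let ?L = "{xs. set xs \<subseteq> {0..N} \<and> length xs = R}"
  have "small_subsets N R \<subseteq> (\<lambda>xs. set xs - {0}) ` ?L"
  proof
    fix P assume P: "P \<in> small_subsets N R"
    then have "finite P" unfolding small_subsets_def using finite_subset by blast
    then obtain xs where xs: "set xs = P" "length xs = card P"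
      using finite_distinct_list distinct_card by metis
    let ?ys = "xs @ replicate (R - card P) 0"
    have "?ys \<in> ?L" "set ?ys - {0} = P" using xs P by (auto simp: small_subsets_def)
    then show "P \<in> (\<lambda>xs. set xs - {0}) ` ?L" by (metis (no_types, lifting) image_eqI)
  qed
  moreover have "finite ?L" by (rule finite_lists_length_eq) simp
  ultimately have "card (small_subsets N R) \<le> card ?L" by (rule surj_card_le[rotated])
  then show ?thesis by (simp add: card_lists_length_eq)
qed

section \<open>Densely packed small elements\<close>

text \<open>If no \<open>y\<close> in \<open>C\<close> had \<open>?h y\<close> in \<open>C\<close>,
  then \<open>C\<close> and the image of \<open>C1\<close> under \<open>?h\<close> would be disjoint
  subsets of \<open>{s..N}\<close>; each exceptional \<open>y\<close> adds at most one to their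
  overlap. Since \<open>C1\<close> loses only points above \<open>M\<close>, this bounds
  \<open>2 * card C\<close>. At \<open>s = N / (p + q)\<close> the main terms equal
  \<open>2 * q * (N - N / (p + q))\<close>.\<close>

lemma card_nearly_free:
  fixes p q s N :: nat
  assumes q: "1 \<le> q" "q \<le> p" and C: "C \<subseteq> {s..N}" and s: "(p + q) * s \<le> N"
  shows "2 * real q * real (card C) \<le> (2 * real q - 1) * real N + (real p - real q) * real s
           + 2 * real q + real q * real (card {y\<in>C. q * y + p * s \<in> C})"
proof -
  let ?h = "\<lambda>y. q * y + p * s"
  let ?X = "{y\<in>C. ?h y \<in> C}"
  \<comment> \<open>The largest \<open>y\<close> whose image \<open>?h y\<close> is still at most
    \<open>N\<close>.\<close>
  define M where "M = (N - p * s) div q"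
  have ps: "p * s + q * s \<le> N" using s by (simp add: algebra_simps)
  have fC: "finite C" using C finite_subset by blast
  have Mle: "q * M \<le> N - p * s" unfolding M_def by simp
  have Mge: "N - p * s < q * M + q"
    unfolding M_def using q dividend_less_times_div[of q "N - p * s"] by simp
  have MN: "M \<le> N"
  proof -
    have "1 * M \<le> q * M" using q by (intro mult_right_mono) auto
    then show ?thesis using Mle by linarith
  qed
  define C1 where "C1 = C \<inter> {s..M}"
  have inj: "inj_on ?h C1" using q by (auto simp: inj_on_def)
  have h1: "?h ` C1 \<subseteq> {s..N}"
  proof
    fix z assume "z \<in> ?h ` C1"
    then obtain y where y: "s \<le> y" "y \<le> M" "z = ?h y" by (auto simp: C1_def)
    have "q * y \<le> q * M" "1 * y \<le> q * y" using y q by (auto intro: mult_le_mono)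
    then have "z \<le> N" "s \<le> z" using y Mle ps by linarith+
    then show "z \<in> {s..N}" by simp
  qed
  have "C \<inter> ?h ` C1 \<subseteq> ?h ` ?X" by (auto simp: C1_def)
  then have "card (C \<inter> ?h ` C1) \<le> card (?h ` ?X)" using fC by (intro card_mono) auto
  also have "\<dots> \<le> card ?X" using fC by (intro card_image_le) auto
  finally have i: "card (C \<inter> ?h ` C1) \<le> card ?X" .
  have "card C + card (?h ` C1) = card (C \<union> ?h ` C1) + card (C \<inter> ?h ` C1)"
    using fC by (intro card_Un_Int) (auto simp: C1_def)
  moreover have "card (C \<union> ?h ` C1) \<le> card {s..N}" using C h1 by (intro card_mono) auto
  moreover have "card (?h ` C1) = card C1" using inj by (rule card_image)
  moreover have "s \<le> N"
  proof -
    have "1 * s \<le> q * s" using q by (intro mult_le_mono1) auto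
    then show ?thesis using ps by linarith
  qed
  ultimately have 1: "card C + card C1 + s \<le> N + 1 + card ?X" using i by simp
  have "C = C1 \<union> (C \<inter> {M+1..N})" using C by (auto simp: C1_def)
  then have "card C \<le> card C1 + card (C \<inter> {M+1..N})" by (metis card_Un_le)
  moreover have "card (C \<inter> {M+1..N}) \<le> card {M+1..N}" by (intro card_mono) auto
  ultimately have 2: "card C + M \<le> card C1 + N" using MN by simp
  have "2 * real (card C) + real M + real s \<le> 2 * real N + 1 + real (card ?X)"
    using 1 2 by linarith
  then have "real q * (2 * real (card C) + real M + real s) \<le> real q * (2 * real N + 1 + real (card ?X))"
    by (intro mult_left_mono) auto
  moreover have "real N \<le> real q * real M + real q + real p * real s"
  proof -
    have "N \<le> q * M + q + p * s" using Mge by linarith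
    then have "real N \<le> real (q * M + q + p * s)" by (rule of_nat_mono)
    then show ?thesis by simp
  qed
  ultimately show ?thesis by (simp add: algebra_simps)
qed

text \<open>Each \<open>y\<close> in \<open>C\<close> has at most \<open>e\<close> edges, so by
  averaging some label \<open>s\<close> in \<open>S\<close> carries at most
  \<open>e * N / card S\<close> of them, and \<open>card_nearly_free\<close> applies to this
  \<open>s\<close>. The elements of \<open>C\<close> below \<open>s\<close>, at most
  \<open>w\<close> in number, are given away.\<close>

lemma card_sparse_link:
  fixes p q a w N e :: nat
  assumes q: "1 \<le> q" "q \<le> p" and N: "(p + q) * (a + w) \<le> N"
    and S: "S \<subseteq> {a+1..a+w}" "S \<noteq> {}" and C: "C \<subseteq> {a+1..N}"
    and deg: "\<And>y. y \<in> C \<Longrightarrow> card {s\<in>S. q * y + p * s \<in> C} \<le> e"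
  shows "real (card C) \<le> real N - real N / (2 * real q)
     + (real p - real q) * real (a + w) / (2 * real q) + 1 + real w + real e * real N / real (card S)"
proof -
  let ?X = "\<lambda>s. {y\<in>C. q * y + p * s \<in> C}"
  have fC: "finite C" and fS: "finite S" using C S finite_subset by blast+
  have K: "0 < card S" using S fS by (simp add: card_gt_0_iff)
  have cN: "card C \<le> N" using card_mono[OF _ C] by simp
  have "(\<Sum>s\<in>S. card (?X s)) = (\<Sum>y\<in>C. card {s\<in>S. q * y + p * s \<in> C})"
    using sum.swap_restrict[OF fS fC, of "\<lambda>_ _. 1::nat" "\<lambda>s y. q * y + p * s \<in> C"] by simp
  also have "\<dots> \<le> card C * e" using deg by (intro order.trans[OF sum_bounded_above[of _ _ e]]) auto
  also have "\<dots> \<le> N * e" using cN by simp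
  finally have tot: "(\<Sum>s\<in>S. card (?X s)) \<le> N * e" .
  obtain s where s: "s \<in> S" "card S * card (?X s) \<le> N * e"
  proof (rule ccontr)
    assume "\<not> thesis"
    then have *: "N * e < card S * card (?X s)" if "s \<in> S" for s using that \<open>\<And>s. s \<in> S \<Longrightarrow> card S * card (?X s) \<le> N * e \<Longrightarrow> thesis\<close> not_le by blast
    have "card S * (N * e) = (\<Sum>s\<in>S. N * e)" by simp
    also have "\<dots> < (\<Sum>s\<in>S. card S * card (?X s))" using * S fS by (intro sum_strict_mono) auto
    also have "\<dots> = card S * (\<Sum>s\<in>S. card (?X s))" by (simp add: sum_distrib_left)
    also have "\<dots> \<le> card S * (N * e)" using tot by simp
    finally show False by simp
  qed
  have sw: "a < s" "s \<le> a + w" using s S by auto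
  let ?D = "C \<inter> {s..N}"
  have "C \<subseteq> {a+1..<s} \<union> ?D" using C by auto
  then have "card C \<le> card ({a+1..<s} \<union> ?D)" using fC by (intro card_mono) auto
  also have "\<dots> \<le> card {a+1..<s} + card ?D" by (rule card_Un_le)
  also have "card {a+1..<s} \<le> w" using sw by simp
  finally have cd: "real (card C) \<le> real w + real (card ?D)" by linarith
  have "card {y\<in>?D. q * y + p * s \<in> ?D} \<le> card (?X s)" using fC by (intro card_mono) auto
  then have "card S * card {y\<in>?D. q * y + p * s \<in> ?D} \<le> N * e"
    using s(2) by (meson le_trans mult_le_mono2)
  then have "real (card S * card {y\<in>?D. q * y + p * s \<in> ?D}) \<le> real (N * e)" by (rule of_nat_mono)
  then have x: "real (card {y\<in>?D. q * y + p * s \<in> ?D}) \<le> real e * real N / real (card S)"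
    using K by (simp add: field_simps)
  have "(p + q) * s \<le> (p + q) * (a + w)" using sw by (intro mult_le_mono2)
  then have "(p + q) * s \<le> N" using N by linarith
  have expand: "2 * real q * (u - u / (2 * real q) + v / (2 * real q) + 1 + x)
      = (2 * real q - 1) * u + v + 2 * real q + 2 * real q * x" for u v x :: real
    using q by (simp add: field_simps)
  from card_nearly_free[OF q _ \<open>(p + q) * s \<le> N\<close>, of ?D]
  have "2 * real q * real (card ?D) \<le> (2 * real q - 1) * real N + (real p - real q) * real s
           + 2 * real q + real q * real (card {y\<in>?D. q * y + p * s \<in> ?D})" by simp
  also have "real q * real (card {y\<in>?D. q * y + p * s \<in> ?D}) \<le> 2 * real q * (real e * real N / real (card S))"
    using x q by (intro mult_mono) auto
  also have "(real p - real q) * real s \<le> (real p - real q) * real (a + w)"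
    using q sw by (intro mult_left_mono) auto
  finally have "2 * real q * real (card ?D) \<le> 2 * real q * (real N - real N / (2 * real q)
     + (real p - real q) * real (a + w) / (2 * real q) + 1 + real e * real N / real (card S))"
    by (simp only: expand)
  then have "real (card ?D) \<le> real N - real N / (2 * real q)
     + (real p - real q) * real (a + w) / (2 * real q) + 1 + real e * real N / real (card S)"
    using q by (subst (asm) mult_le_cancel_left_pos) auto
  then show ?thesis using cd by simp
qed

lemma card_blocks_le:
  assumes "\<And>j. j < i \<Longrightarrow> card (T \<inter> {j*w+1..j*w+w}) \<le> K"
  shows "card (T \<inter> {1..i*w}) \<le> i * K"
  using assms
proof (induction i)
  case (Suc i)
  have "T \<inter> {1..Suc i*w} \<subseteq> (T \<inter> {1..i*w}) \<union> (T \<inter> {i*w+1..i*w+w})" by auto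
  then have "card (T \<inter> {1..Suc i*w}) \<le> card ((T \<inter> {1..i*w}) \<union> (T \<inter> {i*w+1..i*w+w}))"
    by (intro card_mono) auto
  also have "\<dots> \<le> card (T \<inter> {1..i*w}) + card (T \<inter> {i*w+1..i*w+w})" by (rule card_Un_le)
  also have "\<dots> \<le> i * K + K" using Suc by (intro add_mono) auto
  finally show ?case by simp
qed simp

lemma two_power_floor_le: "0 \<le> b \<Longrightarrow> (2::real) ^ nat \<lfloor>b\<rfloor> \<le> 2 powr b"
  by (simp add: powr_realpow[symmetric])

text \<open>\<open>T\<close> is encoded by the index \<open>j\<close> of its first dense block, its
  part \<open>P\<close> before that block, \<open>K\<close> elements \<open>S\<close> of the block,
  and its part beyond \<open>j * w\<close>. Earlier blocks hold fewer than \<open>K\<close> elements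
  each, so \<open>P\<close> is small and, for fixed \<open>J\<close> and \<open>K\<close>, the
  triples are polynomially many. The last part is independent in the digraph with edges from
  \<open>y\<close> to \<open>q * y + p * s\<close>, \<open>s\<close> in \<open>S\<close>, and is
  counted by \<open>card_independent_le\<close>.\<close>

lemma card_dense_le:
  fixes p q w N J K e :: nat and l :: real
  assumes q: "1 \<le> q" "q \<le> p" and N: "(p + q) * (J * w) \<le> N" and K: "1 \<le> K"
    and l: "1 \<le> l" "l ^ e + 1 \<le> l ^ Suc e"
  shows "real (card {T \<in> L_free_subsets p q N. \<exists>j<J. K \<le> card (T \<inter> {j*w+1..j*w+w})})
     \<le> real J * real (N + 1) ^ (J * K + K)
        * (2 powr (real N - real N / (2 * real q) + (real p - real q) * real (J * w) / (2 * real q)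
             + 1 + real w + real e * real N / real K) * l ^ N)"
    (is "real (card ?A) \<le> _ * (2 powr ?b * _)")
proof -
  let ?out = "\<lambda>S y. (\<lambda>s. q * y + p * s) ` S"
  let ?ind = "\<lambda>j S. {I. I \<subseteq> {j*w+1..N} \<and> (\<forall>y\<in>I. ?out S y \<inter> I = {})}"
  let ?P = "Sigma {..<J} (\<lambda>j. small_subsets N (J * K) \<times> {S\<in>small_subsets N K. S \<subseteq> {j*w+1..j*w+w} \<and> card S = K})"
  let ?F = "\<lambda>(j, P, S). (\<lambda>I. P \<union> I) ` ?ind j S"
  have find: "finite (?ind j S)" for j S
    by (rule finite_subset[of _ "Pow {j*w+1..N}"]) auto
  have bnd: "real (card (?ind j S)) \<le> 2 powr ?b * l ^ N"
    if j: "j < J" and S: "S \<subseteq> {j*w+1..j*w+w}" "card S = K" for j S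
  proof -
    have "Suc j * w \<le> J * w" using j by (intro mult_le_mono1) auto
    then have jw: "j * w + w \<le> J * w" by simp
    have Nj: "(p + q) * (j * w + w) \<le> N" using N jw by (meson le_trans mult_le_mono2)
    \<comment> \<open>Out-neighbours of \<open>y\<close> correspond one to one to labels
      \<open>s\<close>, so small out-degrees give the degree condition of
      \<open>card_sparse_link\<close>.\<close>
    have cB: "card C \<le> nat \<lfloor>?b\<rfloor>"
      if C: "C \<subseteq> {j*w+1..N}" "\<forall>y\<in>C. card (?out S y \<inter> C) \<le> e" for C
    proof -
      have "card {s\<in>S. q * y + p * s \<in> C} \<le> e" if "y \<in> C" for y
      proof -
        have "?out S y \<inter> C = (\<lambda>s. q * y + p * s) ` {s\<in>S. q * y + p * s \<in> C}" by auto
        moreover have "inj_on (\<lambda>s. q * y + p * s) {s\<in>S. q * y + p * s \<in> C}"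
          using q by (auto simp: inj_on_def)
        ultimately have "card (?out S y \<inter> C) = card {s\<in>S. q * y + p * s \<in> C}"
          by (simp add: card_image)
        then show ?thesis using C(2)[rule_format, OF that] by linarith
      qed
      moreover have "S \<noteq> {}" using S K by auto
      ultimately have "real (card C) \<le> real N - real N / (2 * real q)
        + (real p - real q) * real (j * w + w) / (2 * real q) + 1 + real w + real e * real N / real (card S)"
        by (intro card_sparse_link[OF q Nj S(1) _ C(1)])
      \<comment> \<open>Moving the block end to \<open>J * w\<close> makes the bound independent of
        \<open>j\<close>; the direction is right because \<open>q \<le> p\<close>.\<close>
      also have "(real p - real q) * real (j * w + w) / (2 * real q) \<le> (real p - real q) * real (J * w) / (2 * real q)"
        using q jw by (intro divide_right_mono mult_left_mono of_nat_mono) auto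
      finally have "real (card C) \<le> ?b" using S by simp
      then show ?thesis by linarith
    qed
    have "real (card (?ind j S)) \<le> 2 ^ nat \<lfloor>?b\<rfloor> * l ^ card {j*w+1..N}"
      by (rule card_independent_le[OF finite_atLeastAtMost l cB])
    also have "\<dots> \<le> 2 powr ?b * l ^ N"
    proof (rule mult_mono)
      \<comment> \<open>\<open>nat\<close> truncates negative values to 0, so passing to the real
        exponent \<open>?b\<close> requires it to be nonnegative.\<close>
      have "0 \<le> ?b"
      proof -
        have "real N / (2 * real q) \<le> real N / 1" using q by (intro divide_left_mono) auto
        moreover have "0 \<le> (real p - real q) * real (J * w) / (2 * real q)" using q by simp
        moreover have "0 \<le> real e * real N / real K" by simp
        ultimately show ?thesis by (simp only: div_by_1)
      qed
      then show "(2::real) ^ nat \<lfloor>?b\<rfloor> \<le> 2 powr ?b"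
        by (rule two_power_floor_le)
      show "l ^ card {j*w+1..N} \<le> l ^ N" using l(1) by (intro power_increasing) auto
    qed (use l(1) in simp_all)
    finally show ?thesis .
  qed
  have "real (card ?A) \<le> real (card ?P) * (2 powr ?b * l ^ N)"
  proof (rule card_Union_bound)
    show "finite ?P" by auto
    show "finite (?F i)" for i using find by (cases i) auto
    show "real (card (?F i)) \<le> 2 powr ?b * l ^ N" if i: "i \<in> ?P" for i
    proof -
      obtain j P S where [simp]: "i = (j, P, S)" by (cases i)
      have "card (?F i) \<le> card (?ind j S)" using find[of j S] by (simp add: card_image_le)
      then show ?thesis using bnd[of j S] i by force
    qed
    show "?A \<subseteq> (\<Union>i\<in>?P. ?F i)"
    proof
      fix T assume T: "T \<in> ?A"
      let ?D = "\<lambda>j. K \<le> card (T \<inter> {j*w+1..j*w+w})"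
      define j where "j = (LEAST j. ?D j)"
      from T obtain j0 where j0: "j0 < J" "?D j0" by auto
      have Dj: "?D j" unfolding j_def using j0(2) by (rule LeastI)
      have jJ: "j < J" using j0 Least_le[of ?D j0] unfolding j_def by linarith
      have "card (T \<inter> {1..j*w}) \<le> j * K"
        using not_less_Least[of _ ?D] unfolding j_def
        by (intro card_blocks_le) (meson nat_le_linear)
      also have "\<dots> \<le> J * K" using jJ by simp
      finally have small: "card (T \<inter> {1..j*w}) \<le> J * K" .
      obtain S where S: "S \<subseteq> T \<inter> {j*w+1..j*w+w}" "card S = K"
        using Dj obtain_subset_with_card_n by metis
      have TN: "T \<subseteq> {1..N}" "L_free p q T" using T by (auto simp: L_free_subsets_def)
      have "(j, T \<inter> {1..j*w}, S) \<in> ?P"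
        using jJ S TN small by (auto simp: small_subsets_def)
      moreover have "T \<inter> {j*w+1..N} \<in> ?ind j S"
        using S L_freeD[OF TN(2)] by (auto simp: add.commute)
      moreover have "T = (T \<inter> {1..j*w}) \<union> (T \<inter> {j*w+1..N})" using TN by auto
      ultimately show "T \<in> (\<Union>i\<in>?P. ?F i)" by blast
    qed
  qed
  also have "real (card ?P) \<le> real J * real (N + 1) ^ (J * K + K)"
  proof -
    have "card ?P = (\<Sum>j<J. card (small_subsets N (J * K) \<times> {S\<in>small_subsets N K. S \<subseteq> {j*w+1..j*w+w} \<and> card S = K}))"
      by (intro card_SigmaI) auto
    also have "\<dots> \<le> (\<Sum>j<J. (N + 1) ^ (J * K) * (N + 1) ^ K)"
      unfolding card_cartesian_product
      by (intro sum_mono mult_le_mono card_small_subsets order.trans[OF card_mono card_small_subsets]) auto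
    also have "\<dots> = J * (N + 1) ^ (J * K + K)" by (simp add: power_add)
    finally have "real (card ?P) \<le> real (J * (N + 1) ^ (J * K + K))" by (rule of_nat_mono)
    then show ?thesis by simp
  qed
  finally show ?thesis using l(1) by (simp add: mult_right_mono)
qed


section \<open>Sparse small elements\<close>

lemma card_sparse_le:
  assumes "finite G" and "\<And>T. T \<in> X \<Longrightarrow> T \<subseteq> {1..N} \<and> card (T \<inter> {1..A}) \<le> R \<and> T \<inter> {A+1..N} \<in> G"
  shows "real (card X) \<le> real (N + 1) ^ R * real (card G)"
proof -
  have "X \<subseteq> (\<lambda>(P, I). P \<union> I) ` (small_subsets N R \<times> G)"
  proof
    fix T assume T: "T \<in> X"
    then have *: "T \<subseteq> {1..N}" "card (T \<inter> {1..A}) \<le> R" "T \<inter> {A+1..N} \<in> G" using assms(2) by auto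
    then have "T = (T \<inter> {1..A}) \<union> (T \<inter> {A+1..N})" "T \<inter> {1..A} \<in> small_subsets N R"
      by (auto simp: small_subsets_def)
    then show "T \<in> (\<lambda>(P, I). P \<union> I) ` (small_subsets N R \<times> G)"
      using *(3) by (intro image_eqI[of _ _ "(T \<inter> {1..A}, T \<inter> {A+1..N})"]) auto
  qed
  then have "card X \<le> card (small_subsets N R \<times> G)"
    using assms(1) by (intro surj_card_le) auto
  also have "\<dots> \<le> (N + 1) ^ R * card G"
    unfolding card_cartesian_product by (intro mult_le_mono1 card_small_subsets)
  finally have "real (card X) \<le> real ((N + 1) ^ R * card G)" by (rule of_nat_mono)
  then show ?thesis by simp
qed

text \<open>The edges from \<open>y\<close> to \<open>q * y + p * m\<close> with
  \<open>m \<le> y \<le> Y\<close> form a matching in \<open>{m..N}\<close>, since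
  \<open>N < (2 * p + q) * m\<close> puts every image above \<open>Y\<close>. Up to a factor 2,
  admitting the points from \<open>m\<close> to \<open>u\<close> costs \<open>2 ^ (u - m)\<close>;
  but there are at least \<open>5 / 2 * (u - m)\<close> edges, and
  \<open>2 * (3 / 4) powr (5 / 2) = sqrt (243 / 256) < 1\<close>.\<close>

lemma card_large_min_le:
  fixes p q m N :: nat
  assumes q: "1 \<le> q" "5 * q \<le> 2 * (p + q)" and m: "N < (2 * p + q) * m" "m \<le> N div (p + q)"
  shows "real (card {T \<in> L_free_subsets p q N. m \<in> T \<and> T \<subseteq> {m..N}})
     \<le> 2 * 2 ^ (N - N div (p + q)) * sqrt (243 / 256) ^ (N div (p + q) - m)"
proof -
  define u where "u = N div (p + q)"
  define Y where "Y = (N - p * m) div q"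
  let ?h = "\<lambda>y. q * y + p * m"
  let ?F = "{I. I \<subseteq> {m..N} \<and> (\<forall>y\<in>{m..Y}. \<not> (y \<in> I \<and> ?h y \<in> I))}"
  have mu: "m \<le> u" using m by (simp add: u_def)
  have kuN: "(p + q) * u \<le> N" by (simp add: u_def)
  have "(p + q) * m \<le> (p + q) * u" using mu by (rule mult_le_mono2)
  then have kmN: "p * m + q * m \<le> N" using kuN unfolding add_mult_distrib by linarith
  have qY: "q * Y \<le> N - p * m" by (simp add: Y_def)
  have qY': "N - p * m < q * Y + q"
    unfolding Y_def using q dividend_less_times_div[of q "N - p * m"] by simp
  have YN: "Y \<le> q * Y" using q by simp
  have lt: "N < p * m + q * m + p * m" using m(1) by (simp add: algebra_simps)
  have fF: "finite ?F" by (rule finite_subset[of _ "Pow {m..N}"]) auto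
  have "{T \<in> L_free_subsets p q N. m \<in> T \<and> T \<subseteq> {m..N}} \<subseteq> ?F"
    using L_freeD[of p q] by (auto simp: L_free_subsets_def add.commute)
  then have "card {T \<in> L_free_subsets p q N. m \<in> T \<and> T \<subseteq> {m..N}} \<le> card ?F"
    using fF by (intro card_mono)
  then have "real (card {T \<in> L_free_subsets p q N. m \<in> T \<and> T \<subseteq> {m..N}}) \<le> real (card ?F)"
    by (rule of_nat_mono)
  also have "\<dots> \<le> 2 ^ card {m..N} * (3 / 4) ^ card {m..Y}"
  proof (rule card_matching_avoiding_le)
    have "Y \<le> N" using YN qY by linarith
    then show "{m..Y} \<subseteq> {m..N}" by auto
    show "inj_on ?h {m..Y}" using q by (auto simp: inj_on_def)
    show "?h ` {m..Y} \<subseteq> {m..N} - {m..Y}"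
    proof
      fix z assume "z \<in> ?h ` {m..Y}"
      then obtain y where y: "m \<le> y" "y \<le> Y" "z = ?h y" by auto
      have "q * y \<le> q * Y" "q * m \<le> q * y" "1 * y \<le> q * y" using y q by (auto intro: mult_le_mono)
      then have "z \<le> N" "Y < z" "m \<le> z" using y qY kmN lt YN by linarith+
      then show "z \<in> {m..N} - {m..Y}" by auto
    qed
  qed simp
  \<comment> \<open>Squaring both sides avoids the half-integral exponent
    \<open>5 / 2\<close>.\<close>
  also have "(3 / 4 :: real) ^ card {m..Y} \<le> sqrt ((3 / 4) ^ 5) ^ (u - m)"
  proof (rule power2_le_imp_le)
    have "(p + q) * u < q * Y + q + p * m" using qY' kuN by linarith
    then have "(p + q) * (u - m) + (p + q) * m < q * Y + q + p * m"
      using mu by (simp flip: distrib_left)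
    then have "(p + q) * (u - m) + q * m < q * (Y + 1)" by (simp add: algebra_simps)
    moreover have "q * (Y + 1) \<le> q * ((Suc Y - m) + m)" by (rule mult_le_mono2) simp
    then have "q * (Y + 1) \<le> q * (Suc Y - m) + q * m" by (simp only: distrib_left)
    ultimately have *: "(p + q) * (u - m) \<le> q * (Suc Y - m)" by linarith
    have "q * (5 * (u - m)) = 5 * q * (u - m)" by simp
    also have "\<dots> \<le> 2 * (p + q) * (u - m)" using q(2) by (rule mult_le_mono1)
    also have "\<dots> = 2 * ((p + q) * (u - m))" by simp
    also have "\<dots> \<le> 2 * (q * (Suc Y - m))" using * by (rule mult_le_mono2)
    also have "\<dots> = q * (2 * (Suc Y - m))" by simp
    finally have "5 * (u - m) \<le> 2 * (Suc Y - m)" using q by simp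
    then have "(3 / 4 :: real) ^ (2 * (Suc Y - m)) \<le> (3 / 4) ^ (5 * (u - m))"
      by (intro power_decreasing) auto
    also have "\<dots> = (sqrt ((3 / 4) ^ 5) ^ 2) ^ (u - m)" by (subst power_mult) simp
    finally show "((3 / 4 :: real) ^ card {m..Y})\<^sup>2 \<le> (sqrt ((3 / 4) ^ 5) ^ (u - m))\<^sup>2"
      by (simp only: card_atLeastAtMost power_mult[symmetric] mult.commute)
  qed simp
  also have "(2 :: real) ^ card {m..N} = 2 * 2 ^ (N - u) * 2 ^ (u - m)"
  proof -
    have "u \<le> N" by (simp add: u_def)
    then have "card {m..N} = 1 + (N - u) + (u - m)" using mu by simp
    then show ?thesis by (simp only: power_add power_one_right)
  qed
  also have "2 * 2 ^ (N - u) * 2 ^ (u - m) * sqrt ((3 / 4) ^ 5) ^ (u - m)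
      = 2 * 2 ^ (N - u) * (2 * sqrt ((3 / 4) ^ 5)) ^ (u - m)"
    by (simp add: power_mult_distrib)
  also have "2 * sqrt ((3 / 4) ^ 5) = sqrt (243 / 256)"
    by (rule real_sqrt_unique[symmetric]) (simp_all add: power_mult_distrib power_divide)
  finally show ?thesis by (simp add: u_def mult_left_mono)
qed

text \<open>Complements \<open>card_large_min_le\<close>: for \<open>m\<close> up to
  \<open>N / (2 * p + q)\<close> the roles are swapped, and the edges run from \<open>x\<close> to
  \<open>p * x + q * m\<close>. The bound \<open>2 * N div (2 * p + q) \<le> p * A\<close> places
  every image beyond all sources \<open>x\<close>, so they form a matching above \<open>A\<close>.
  The at most \<open>R\<close> elements up to \<open>A\<close> are listed at polynomial
  cost.\<close>

lemma card_sparse_small_element_le: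
  fixes p q m N A R :: nat
  assumes p: "1 \<le> p" and m: "1 \<le> m" "(2 * p + q) * m \<le> N"
    and A: "2 * N div (2 * p + q) \<le> p * A" "A \<le> N"
  shows "real (card {T \<in> L_free_subsets p q N. m \<in> T \<and> card (T \<inter> {1..A}) \<le> R})
     \<le> real (N + 1) ^ R * (2 ^ (N - A) * (3 / 4) ^ (2 * N div (2 * p + q) - A))"
proof -
  \<comment> \<open>Up to rounding, the solution \<open>x\<close> of
    \<open>p * x + q * m = N\<close> for the extreme value \<open>m = N / (2 * p + q)\<close>; thus
    \<open>?h Y \<le> N\<close> for every admissible \<open>m\<close>.\<close>
  define Y where "Y = 2 * N div (2 * p + q)"
  let ?h = "\<lambda>x. p * x + q * m"
  let ?G = "{I. I \<subseteq> {A+1..N} \<and> (\<forall>x\<in>{A+1..Y}. \<not> (x \<in> I \<and> ?h x \<in> I))}"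
  have fG: "finite ?G" by (rule finite_subset[of _ "Pow {A+1..N}"]) auto
  have hY: "?h Y \<le> N"
  proof -
    have "(2 * p + q) * Y \<le> 2 * N" by (simp add: Y_def)
    then have "p * ((2 * p + q) * Y) + q * ((2 * p + q) * m) \<le> p * (2 * N) + q * N"
      using m by (intro add_mono mult_le_mono2)
    then have "(2 * p + q) * ?h Y \<le> (2 * p + q) * N" by (simp add: algebra_simps)
    then show ?thesis using p by simp
  qed
  have YN: "Y \<le> N" using hY p
    by (metis add_leE dual_order.trans le_refl mult_le_mono1 nat_mult_1)
  have "real (card ?G) \<le> 2 ^ card {A+1..N} * (3 / 4) ^ card {A+1..Y}"
  proof (rule card_matching_avoiding_le)
    show "{A+1..Y} \<subseteq> {A+1..N}" using YN by auto
    show "inj_on ?h {A+1..Y}" using p by (auto simp: inj_on_def)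
    show "?h ` {A+1..Y} \<subseteq> {A+1..N} - {A+1..Y}"
    proof
      fix z assume "z \<in> ?h ` {A+1..Y}"
      then obtain x where x: "A + 1 \<le> x" "x \<le> Y" "z = ?h x" by auto
      have "p * x \<le> p * Y" "p * (A + 1) \<le> p * x" "1 * x \<le> p * x"
        using x p by (auto intro: mult_le_mono simp del: mult_Suc_right)
      moreover have "p * (A + 1) = p * A + p" by simp
      ultimately have "z \<le> N" "Y < z" "A + 1 \<le> z" using x hY p A(1) unfolding Y_def[symmetric] by linarith+
      then show "z \<in> {A+1..N} - {A+1..Y}" by auto
    qed
  qed simp
  then have G: "real (card ?G) \<le> 2 ^ (N - A) * (3 / 4) ^ (Y - A)" by simp
  have "real (card {T \<in> L_free_subsets p q N. m \<in> T \<and> card (T \<inter> {1..A}) \<le> R}) \<le> real (N + 1) ^ R * real (card ?G)"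
    using L_freeD[of p q] by (intro card_sparse_le[where A = A] fG) (auto simp: L_free_subsets_def)
  also have "\<dots> \<le> real (N + 1) ^ R * (2 ^ (N - A) * (3 / 4) ^ (Y - A))"
    using G by (intro mult_left_mono) auto
  finally show ?thesis by (simp add: Y_def)
qed

section \<open>Asymptotics\<close>

text \<open>Lets the factor \<open>l ^ card V\<close> of \<open>card_independent_le\<close> grow at
  an arbitrarily small exponential rate, at the price of a large degree threshold
  \<open>e\<close>.\<close>

lemma ex_branching_exponent: "1 < l \<Longrightarrow> \<exists>e. (l::real) ^ e + 1 \<le> l ^ Suc e"
proof -
  assume l: "1 < l"
  then obtain e where "1 / (l - 1) < l ^ e" using real_arch_pow by blast
  then have "1 < l ^ e * (l - 1)" using l by (simp add: pos_divide_less_eq)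
  then show ?thesis by (intro exI[of _ e]) (simp add: algebra_simps)
qed

lemma eventually_poly_le_powr:
  fixes c D :: real
  assumes "0 < c"
  shows "\<forall>\<^sub>F N::nat in sequentially. D * real (N + 1) ^ R \<le> 2 powr (c * real N)"
proof -
  have "(\<lambda>N::nat. D * real (N + 1) ^ R / 2 powr (c * real N)) \<longlonglongrightarrow> 0"
    using assms by real_asymp
  then have "\<forall>\<^sub>F N::nat in sequentially. D * real (N + 1) ^ R / 2 powr (c * real N) < 1"
    by (rule order_tendstoD) simp
  then show ?thesis by eventually_elim (simp add: pos_divide_less_eq)
qed

lemma real_div_bounds:
  assumes "0 < b"
  shows "real (a div b) \<le> real a / real b" "real a / real b - 1 < real (a div b)"
proof -
  have "\<lfloor>real a / real b\<rfloor> = int (a div b)" by (rule floor_divide_of_nat_eq)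
  then show "real (a div b) \<le> real a / real b" "real a / real b - 1 < real (a div b)" by linarith+
qed

text \<open>Fixes the constants of \<open>card_dense_le\<close>: a third of \<open>c\<close> goes to
  the polynomial encoding factor, a third to the branching factor, and a third to
  \<open>e * N / K\<close>. \<open>L\<close> is the number of blocks omitted just below
  \<open>N / (p + q)\<close>; each saves \<open>(p - q) / (2 * q)\<close> block widths in the
  exponent, against the one width lost in \<open>card_sparse_link\<close>.\<close>

lemma eventually_card_dense_le:
  fixes p q J L :: nat and c :: real
  assumes q: "1 \<le> q" "q \<le> p" and J: "1 \<le> J" "L \<le> J" and c: "0 < c"
  obtains K where "1 \<le> K" and "\<forall>\<^sub>F N in sequentially.
    real (card {T \<in> L_free_subsets p q N.
      \<exists>j<J - L. K \<le> card (T \<inter> {j * (N div ((p + q) * J)) + 1..j * (N div ((p + q) * J)) + N div ((p + q) * J)})})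
    \<le> 2 powr (real N - real N / real (p + q)
         + (1 - (real p - real q) * real L / (2 * real q)) * real (N div ((p + q) * J)) + c * real N)"
proof -
  define d where "d = c / 3"
  define l where "l = 2 powr d"
  have d: "0 < d" using c by (simp add: d_def)
  then have l: "1 < l" by (simp add: l_def)
  obtain e where e: "l ^ e + 1 \<le> l ^ Suc e" using ex_branching_exponent[OF l] by blast
  define K where "K = nat \<lceil>real e / d\<rceil> + 1"
  have K: "1 \<le> K" by (simp add: K_def)
  have "real e / d \<le> real K" by (simp add: K_def) linarith
  then have eK: "real e / real K \<le> d" using d K by (simp add: field_simps)
  let ?R = "(J - L) * K + K"
  have "\<forall>\<^sub>F N in sequentially. 2 * real (J - L) * real (N + 1) ^ ?R \<le> 2 powr (d * real N)"
    using eventually_poly_le_powr[OF d] .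
  then have "\<forall>\<^sub>F N in sequentially.
    real (card {T \<in> L_free_subsets p q N.
      \<exists>j<J - L. K \<le> card (T \<inter> {j * (N div ((p + q) * J)) + 1..j * (N div ((p + q) * J)) + N div ((p + q) * J)})})
    \<le> 2 powr (real N - real N / real (p + q)
         + (1 - (real p - real q) * real L / (2 * real q)) * real (N div ((p + q) * J)) + c * real N)"
  proof eventually_elim
    case (elim N)
    define w where "w = N div ((p + q) * J)"
    let ?b = "real N - real N / (2 * real q) + (real p - real q) * real ((J - L) * w) / (2 * real q)
             + 1 + real w + real e * real N / real K"
    \<comment> \<open>The \<open>+ 1\<close> in \<open>?b\<close> becomes a factor 2, already
      included in the polynomial factor of \<open>elim\<close>.\<close>
    have b: "2 powr ?b = 2 * 2 powr (?b - 1)" by (subst powr_diff) simp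
    have "(p + q) * J * w \<le> N" by (simp add: w_def)
    then have kJw: "(p + q) * (J * w) \<le> N" by (simp add: mult.assoc)
    have "(J - L) * w \<le> J * w" by (intro mult_le_mono1) simp
    then have "(p + q) * ((J - L) * w) \<le> N" using kJw by (meson le_trans mult_le_mono2)
    from card_dense_le[OF q this K less_imp_le[OF l] e]
    have "real (card {T \<in> L_free_subsets p q N. \<exists>j<J - L. K \<le> card (T \<inter> {j*w+1..j*w+w})})
       \<le> real (J - L) * real (N + 1) ^ ?R * (2 powr ?b * l ^ N)" .
    also have "\<dots> = (2 * real (J - L) * real (N + 1) ^ ?R) * (2 powr (?b - 1) * l ^ N)"
      unfolding b by (simp only: mult_ac)
    also have "\<dots> \<le> 2 powr (d * real N) * (2 powr (?b - 1) * l ^ N)"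
      using elim l by (intro mult_right_mono) auto
    also have "l ^ N = 2 powr (d * real N)" by (simp add: l_def powr_powr flip: powr_realpow)
    also have "2 powr (d * real N) * (2 powr (?b - 1) * 2 powr (d * real N))
        = 2 powr (?b - 1 + 2 * d * real N)"
    proof -
      have "?b - 1 + 2 * d * real N = d * real N + ((?b - 1) + d * real N)" by simp
      then show ?thesis by (simp only: powr_add)
    qed
    also have "\<dots> \<le> 2 powr (real N - real N / real (p + q)
         + (1 - (real p - real q) * real L / (2 * real q)) * real w + c * real N)"
    proof (rule powr_mono)
      have "real ((p + q) * (J * w)) \<le> real N" using kJw by (rule of_nat_mono)
      then have "real J * real w \<le> real N / real (p + q)" using q by (simp add: field_simps)
      then have "(real p - real q) * (real J * real w) \<le> (real p - real q) * (real N / real (p + q))"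
        using q by (intro mult_left_mono) auto
      moreover have JL: "real ((J - L) * w) = (real J - real L) * real w"
        using J by (simp add: of_nat_diff)
      have "(real p - real q) * real ((J - L) * w)
          = (real p - real q) * (real J * real w) - (real p - real q) * real L * real w"
        unfolding JL by (simp add: algebra_simps)
      ultimately have "(real p - real q) * real ((J - L) * w)
          \<le> (real p - real q) * (real N / real (p + q)) - (real p - real q) * real L * real w"
        by linarith
      then have "(real p - real q) * real ((J - L) * w) / (2 * real q)
          \<le> ((real p - real q) * (real N / real (p + q)) - (real p - real q) * real L * real w) / (2 * real q)"
        by (rule divide_right_mono) simp
      \<comment> \<open>By \<open>(p - q) / (2 * q * (p + q)) = 1 / (2 * q) - 1 / (p + q)\<close>
        the main exponent becomes \<open>N - N / (p + q)\<close>, which matches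
        \<open>mu_L_ge\<close>.\<close>
      also have "\<dots> = real N / (2 * real q) - real N / real (p + q) - (real p - real q) * real L / (2 * real q) * real w"
      proof -
        define s where "s = real (p + q)"
        have s: "0 < s" "real p - real q = s - 2 * real q" using q by (simp_all add: s_def)
        have "(real p - real q) * (real N / s) / (2 * real q) = real N / (2 * real q) - real N / s"
          unfolding s(2) using q s(1) by (simp add: field_simps)
        then show ?thesis unfolding s_def[symmetric] diff_divide_distrib by simp
      qed
      finally have 1: "(real p - real q) * real ((J - L) * w) / (2 * real q)
        \<le> real N / (2 * real q) - real N / real (p + q) - (real p - real q) * real L / (2 * real q) * real w" .
      have "real e / real K * real N \<le> d * real N" using eK by (intro mult_right_mono) auto
      then have "real e * real N / real K \<le> d * real N" by simp
      moreover have "c * real N = 3 * (d * real N)" "2 * d * real N = 2 * (d * real N)"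
        by (simp_all add: d_def)
      moreover have "(1 - (real p - real q) * real L / (2 * real q)) * real w
          = real w - (real p - real q) * real L / (2 * real q) * real w"
        by (simp only: left_diff_distrib mult_1_left)
      ultimately show "?b - 1 + 2 * d * real N \<le> real N - real N / real (p + q)
         + (1 - (real p - real q) * real L / (2 * real q)) * real w + c * real N"
        using 1 by linarith
    qed simp
    finally show ?case by (simp only: w_def)
  qed
  with K show ?thesis by (rule that)
qed

text \<open>The range up to about \<open>N / (p + q)\<close> is cut into \<open>J\<close> blocks. If
  one is dense, \<open>eventually_card_dense_le\<close> applies with no block omitted, and the lost
  width is at most \<open>\<epsilon> / 2 * N\<close> by the choice of \<open>J\<close>. Otherwise at
  most \<open>J * K\<close> elements lie up to \<open>J * w\<close>, and only about
  \<open>N - N / (p + q)\<close> points remain free.\<close>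

lemma eventually_card_L_free_subsets_le:
  fixes p q :: nat and \<epsilon> :: real
  assumes q: "1 \<le> q" "q \<le> p" and \<epsilon>: "0 < \<epsilon>"
  shows "\<forall>\<^sub>F N in sequentially. real (card (L_free_subsets p q N))
           \<le> 2 powr (real N - real N / real (p + q) + \<epsilon> * real N)"
proof -
  define J where "J = nat \<lceil>2 / \<epsilon>\<rceil> + 1"
  have J: "1 \<le> J" by (simp add: J_def)
  have "2 / \<epsilon> \<le> real J" by (simp add: J_def) linarith
  then have J\<epsilon>: "1 / real J \<le> \<epsilon> / 2" using \<epsilon> J by (simp add: field_simps)
  have "0 < \<epsilon> / 4" using \<epsilon> by simp
  then obtain K where K: "1 \<le> K" and dense: "\<forall>\<^sub>F N in sequentially.
    real (card {T \<in> L_free_subsets p q N.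
      \<exists>j<J - 0. K \<le> card (T \<inter> {j * (N div ((p + q) * J)) + 1..j * (N div ((p + q) * J)) + N div ((p + q) * J)})})
    \<le> 2 powr (real N - real N / real (p + q)
         + (1 - (real p - real q) * real 0 / (2 * real q)) * real (N div ((p + q) * J)) + \<epsilon> / 4 * real N)"
    by (rule eventually_card_dense_le[OF q J le0])
  have poly: "\<forall>\<^sub>F N in sequentially. 2 * 2 powr real J * real (N + 1) ^ (J * K) \<le> 2 powr (\<epsilon> * real N)"
    using eventually_poly_le_powr[OF \<epsilon>] .
  \<comment> \<open>Room for a factor 2, so that the dense case takes only half of the claimed
    bound; the 2 in \<open>poly\<close> does the same for the sparse case.\<close>
  have two: "\<forall>\<^sub>F N in sequentially. 2 * real (N + 1) ^ 0 \<le> 2 powr (\<epsilon> / 4 * real N)"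
    using eventually_poly_le_powr[OF \<open>0 < \<epsilon> / 4\<close>] .
  from dense poly two show ?thesis
  proof eventually_elim
    case (elim N)
    define w where "w = N div ((p + q) * J)"
    let ?D = "{T \<in> L_free_subsets p q N. \<exists>j<J. K \<le> card (T \<inter> {j*w+1..j*w+w})}"
    let ?S = "{T \<in> L_free_subsets p q N. card (T \<inter> {1..J*w}) \<le> J * K}"
    let ?x = "real N - real N / real (p + q)"
    have kJ: "0 < (p + q) * J" using q J by simp
    have w1: "real w \<le> real N / real ((p + q) * J)" and w2: "real N / real ((p + q) * J) - 1 < real w"
      unfolding w_def by (rule real_div_bounds[OF kJ])+
    have "real w \<le> real N / real ((p + q) * J)" by (rule w1)
    also have "\<dots> \<le> real N / real J"
    proof (rule divide_left_mono)
      show "real J \<le> real ((p + q) * J)" using q by (intro of_nat_mono) simp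
    qed (use q J in simp_all)
    also have "\<dots> = 1 / real J * real N" by simp
    also have "\<dots> \<le> \<epsilon> / 2 * real N" using J\<epsilon> by (intro mult_right_mono) auto
    finally have w\<epsilon>: "real w \<le> \<epsilon> / 2 * real N" .
    have "L_free_subsets p q N \<subseteq> ?D \<union> ?S"
    proof
      fix T assume T: "T \<in> L_free_subsets p q N"
      show "T \<in> ?D \<union> ?S"
      proof (cases "T \<in> ?D")
        case False
        then have "card (T \<inter> {1..J*w}) \<le> J * K"
          using T by (intro card_blocks_le) (auto simp: not_le intro: less_imp_le)
        then show ?thesis using T by simp
      qed simp
    qed
    then have "card (L_free_subsets p q N) \<le> card (?D \<union> ?S)" by (intro card_mono) auto
    also have "\<dots> \<le> card ?D + card ?S" by (rule card_Un_le)
    finally have "real (card (L_free_subsets p q N)) \<le> real (card ?D) + real (card ?S)" by linarith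
    also have "real (card ?D) \<le> 2 powr (?x + real w + \<epsilon> / 4 * real N)"
      using elim(1) by (simp add: w_def)
    also have "\<dots> \<le> 2 powr (?x + \<epsilon> / 2 * real N + \<epsilon> / 4 * real N)"
      using w\<epsilon> by (intro powr_mono) auto
    also have "\<dots> = 2 powr (?x + \<epsilon> * real N) / 2 powr (\<epsilon> / 4 * real N)"
      by (simp flip: powr_diff) 
    also have "\<dots> \<le> 2 powr (?x + \<epsilon> * real N) / 2"
      using elim(3) by (intro divide_left_mono) auto
    also have "real (card ?S) \<le> real (N + 1) ^ (J * K) * real (card (Pow {J*w+1..N}))"
      by (rule card_sparse_le[where A = "J*w"]) (auto simp: L_free_subsets_def)
    also have "\<dots> \<le> real (N + 1) ^ (J * K) * 2 powr (?x + real J)"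
    proof (rule mult_left_mono)
      \<comment> \<open>Rounding loses at most one point per block; the resulting factor
        \<open>2 powr J\<close> is part of \<open>poly\<close>.\<close>
      have "real J * (real N / real ((p + q) * J) - 1) \<le> real J * real w"
        using w2 by (intro mult_left_mono) auto
      then have "real N / real (p + q) - real J \<le> real (J * w)" using J by (simp add: right_diff_distrib)
      moreover have "J * w \<le> N"
      proof -
        have "J * w \<le> (p + q) * J * w" using q by simp
        also have "\<dots> \<le> N" by (simp add: w_def)
        finally show ?thesis .
      qed
      ultimately have "real (N - J * w) \<le> ?x + real J" by (simp add: of_nat_diff)
      then have "2 powr real (N - J * w) \<le> 2 powr (?x + real J)" by (intro powr_mono) auto
      then show "real (card (Pow {J*w+1..N})) \<le> 2 powr (?x + real J)"
        by (simp add: card_Pow powr_realpow)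
    qed simp
    also have "\<dots> = 2 * 2 powr real J * real (N + 1) ^ (J * K) * 2 powr ?x / 2" by (simp add: powr_add)
    also have "\<dots> \<le> 2 powr (\<epsilon> * real N) * 2 powr ?x / 2"
      using elim(2) by (intro divide_right_mono mult_right_mono) auto
    also have "\<dots> = 2 powr (?x + \<epsilon> * real N) / 2" by (simp add: powr_add)
    finally show ?case by simp
  qed
qed

section \<open>Bound up to a constant factor\<close>

lemma sum_power_diff_le:
  fixes r :: real
  assumes "0 \<le> r" "r < 1"
  shows "(\<Sum>m\<le>u. r ^ (u - m)) \<le> 1 / (1 - r)"
proof -
  have *: "(\<Sum>m\<le>u. r ^ (u - m)) = (\<Sum>i\<le>u. r ^ i)"
    by (rule sum.reindex_bij_witness[of _ "\<lambda>i. u - i" "\<lambda>i. u - i"]) auto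
  have "(1 - r) * (\<Sum>m\<le>u. r ^ (u - m)) = 1 - r ^ Suc u" unfolding * by (rule sum_gp_basic)
  moreover have "0 \<le> r ^ Suc u" using assms by simp
  ultimately have "(1 - r) * (\<Sum>m\<le>u. r ^ (u - m)) \<le> 1" by linarith
  then show ?thesis using assms by (simp add: pos_le_divide_eq mult.commute)
qed

text \<open>The exponent \<open>2 / 5\<close> comes from
  \<open>(3 / 4) ^ 5 = 243 / 1024 < 1 / 4\<close>.\<close>

lemma three_quarters_power_le:
  assumes "x \<le> real n"
  shows "(3 / 4 :: real) ^ n \<le> 2 powr (- (2 / 5) * x)"
proof -
  have "(3 / 4 :: real) \<le> 2 powr (- (2 / 5))"
  proof (rule power_le_imp_le_base)
    have "(2 powr (- (2 / 5)) :: real) ^ Suc 4 = 2 powr (- 2)"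
      by (simp add: powr_powr flip: powr_realpow)
    also have "\<dots> = 1 / 4" by (simp add: powr_minus)
    finally have *: "(2 powr (- (2 / 5)) :: real) ^ Suc 4 = 1 / 4" .
    show "(3 / 4 :: real) ^ Suc 4 \<le> (2 powr (- (2 / 5))) ^ Suc 4"
      unfolding * by (simp add: power_divide)
  qed simp
  then have "(3 / 4 :: real) ^ n \<le> (2 powr (- (2 / 5))) ^ n" by (rule power_mono) simp
  also have "\<dots> = 2 powr (- (2 / 5) * real n)" by (simp add: powr_powr flip: powr_realpow)
  also have "\<dots> \<le> 2 powr (- (2 / 5) * x)" using assms by (intro powr_mono) auto
  finally show ?thesis .
qed

text \<open>The decay in \<open>u - m\<close> makes the sum over all minima \<open>m\<close> a
  geometric series, so it costs a constant and not a power of \<open>N\<close>.\<close>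

lemma card_large_min_Union_le:
  fixes p q N :: nat
  assumes q: "1 \<le> q" "5 * q \<le> 2 * (p + q)"
  shows "real (card {T \<in> L_free_subsets p q N. \<exists>m\<in>T. T \<subseteq> {m..N} \<and> N < (2 * p + q) * m \<and> m \<le> N div (p + q)})
      \<le> 2 / (1 - sqrt (243 / 256)) * 2 ^ (N - N div (p + q))"
proof -
  define u where "u = N div (p + q)"
  define r where "r = sqrt (243 / 256)"
  have r: "0 \<le> r" "r < 1" by (simp_all add: r_def)
  let ?M = "{m. N < (2 * p + q) * m \<and> m \<le> u}"
  let ?F = "\<lambda>m. {T \<in> L_free_subsets p q N. m \<in> T \<and> T \<subseteq> {m..N}}"
  let ?X = "{T \<in> L_free_subsets p q N. \<exists>m\<in>T. T \<subseteq> {m..N} \<and> N < (2 * p + q) * m \<and> m \<le> u}"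
  have "?X \<subseteq> (\<Union>m\<in>?M. ?F m)" by auto
  then have "card ?X \<le> card (\<Union>m\<in>?M. ?F m)" by (intro card_mono) auto
  also have "\<dots> \<le> (\<Sum>m\<in>?M. card (?F m))" by (rule card_UN_le) simp
  finally have "real (card ?X) \<le> real (\<Sum>m\<in>?M. card (?F m))" by (rule of_nat_mono)
  also have "\<dots> = (\<Sum>m\<in>?M. real (card (?F m)))" by simp
  also have "\<dots> \<le> (\<Sum>m\<in>?M. 2 * 2 ^ (N - u) * r ^ (u - m))"
    using card_large_min_le[OF q] by (intro sum_mono) (auto simp: u_def r_def)
  also have "\<dots> \<le> (\<Sum>m\<le>u. 2 * 2 ^ (N - u) * r ^ (u - m))"
    using r by (intro sum_mono2) auto
  also have "\<dots> = 2 * 2 ^ (N - u) * (\<Sum>m\<le>u. r ^ (u - m))" by (simp add: sum_distrib_left)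
  also have "\<dots> \<le> 2 * 2 ^ (N - u) * (1 / (1 - r))"
    using sum_power_diff_le[OF r] by (intro mult_left_mono) auto
  finally show ?thesis by (simp add: u_def r_def)
qed

text \<open>The matching reaches from \<open>A\<close> to about \<open>2 * N / a\<close>, hence has
  at least \<open>c * N - 1\<close> edges with \<open>c = 2 / a - 1 / k\<close>, and gains about
  \<open>2 / 5 * c * N\<close> in the exponent. The choice of \<open>J\<close> makes stopping
  \<open>4 * q\<close> blocks early cost only \<open>c / 6 * N\<close>, and another
  \<open>c / 6 * N\<close> absorbs polynomial and bounded factors;
  \<open>1 / 6 + 1 / 6 < 2 / 5\<close>.\<close>

lemma eventually_card_small_element_le:
  fixes p q J R :: nat
  assumes q: "1 \<le> q" "3 \<le> p" and J: "J = 24 * (2 * p + q)"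
  shows "\<forall>\<^sub>F N in sequentially. real (card {T \<in> L_free_subsets p q N. \<exists>m\<in>T. (2 * p + q) * m \<le> N
            \<and> card (T \<inter> {1..(J - 4 * q) * (N div ((p + q) * J))}) \<le> R})
      \<le> 2 powr (real N - real N / real (p + q))"
proof -
  define k where "k = real (p + q)"
  define a where "a = real (2 * p + q)"
  define c where "c = real q / (a * k)"
  have pos: "0 < k" "0 < a" "0 < real q" "k \<le> a" "real q \<le> a" using q by (auto simp: k_def a_def)
  have c: "0 < c" using pos by (simp add: c_def)
  have ck: "c \<le> 1 / k" using pos by (simp add: c_def field_simps)
  have ac: "2 / a - 1 / k = c"
  proof -
    have "2 * k - a = real q" by (simp add: k_def a_def)
    then show ?thesis using pos by (simp add: c_def field_simps)
  qed
  have JR: "real J = 24 * a" by (simp add: J a_def)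
  have "\<forall>\<^sub>F N in sequentially. 2 powr (real J + 1) * real (N + 1) ^ (R + 1) \<le> 2 powr (c / 6 * real N)"
    using c by (intro eventually_poly_le_powr) simp
  moreover have "\<forall>\<^sub>F N in sequentially. nat \<lceil>6 * k * real J\<rceil> \<le> N" by (rule eventually_ge_at_top)
  ultimately show ?thesis
  proof eventually_elim
    case (elim N)
    define w where "w = N div ((p + q) * J)"
    define A where "A = (J - 4 * q) * w"
    define Y where "Y = 2 * N div (2 * p + q)"
    have kJ: "0 < (p + q) * J" using q J by simp
    have Nbig: "6 * k * real J \<le> real N" using elim(2) by linarith
    have w1: "real w \<le> real N / real ((p + q) * J)" and w2: "real N / real ((p + q) * J) - 1 < real w"
      unfolding w_def by (rule real_div_bounds[OF kJ])+
    have Y1: "real Y \<le> real (2 * N) / a" and Y2: "real (2 * N) / a - 1 < real Y"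
      unfolding Y_def a_def using q by (auto intro!: real_div_bounds simp del: of_nat_add of_nat_mult)
    have JA: "real (J - 4 * q) = real J - 4 * real q" using J by (simp add: of_nat_diff)
    have A_ge: "real N / k - c / 6 * real N - real J \<le> real A"
    proof -
      define X where "X = real N / (k * (24 * a))"
      have "real N / real ((p + q) * J) = X" by (simp add: k_def JR X_def)
      then have "X - 1 \<le> real w" using w2 by linarith
      then have "(24 * a - 4 * real q) * (X - 1) \<le> (24 * a - 4 * real q) * real w"
        using pos by (intro mult_left_mono) auto
      moreover have "(24 * a - 4 * real q) * (X - 1) = (24 * a - 4 * real q) * X - (24 * a - 4 * real q)"
        by (simp only: right_diff_distrib mult_1_right)
      moreover have "(24 * a - 4 * real q) * X = real N / k - c / 6 * real N"
        using pos by (simp add: c_def X_def field_simps)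
      moreover have "real A = (24 * a - 4 * real q) * real w" by (simp only: A_def of_nat_mult JA JR)
      ultimately show ?thesis using JR by linarith
    qed
    have A_le: "real A \<le> real N / k"
    proof -
      have "A \<le> J * w" unfolding A_def by (intro mult_le_mono1) simp
      then have "real A \<le> real (J * w)" by (rule of_nat_mono)
      also have "\<dots> = real J * real w" by simp
      also have "\<dots> \<le> real J * (real N / real ((p + q) * J))" using w1 by (rule mult_left_mono) simp
      also have "\<dots> = real N / k" using pos JR by (simp add: k_def)
      finally show ?thesis .
    qed
    have "1 \<le> k" using q by (simp add: k_def)
    then have "real N / k \<le> real N" by (simp add: divide_le_eq mult_le_cancel_left1)
    then have AN: "A \<le> N" using A_le by linarith
    \<comment> \<open>Here \<open>3 \<le> p\<close> enters: \<open>Y\<close> is at most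
      \<open>2 * N / k\<close>, while \<open>3 * A\<close> falls short of \<open>3 * N / k\<close>
      by at most \<open>N / k\<close>, thanks to \<open>c \<le> 1 / k\<close> and
      \<open>6 * k * J \<le> N\<close>.\<close>
    have YA: "Y \<le> p * A"
    proof -
      have "real Y \<le> real (2 * N) / k"
        using Y1 pos by (meson divide_left_mono mult_pos_pos of_nat_0_le_iff order_trans)
      also have "\<dots> \<le> 3 * (real N / k - c / 6 * real N - real J)"
      proof -
        have "c * real N \<le> 1 / k * real N" using ck by (rule mult_right_mono) simp
        moreover have "6 * real J \<le> real N / k" using Nbig pos by (simp add: field_simps)
        ultimately show ?thesis by simp
      qed
      also have "\<dots> \<le> 3 * real A" using A_ge by simp
      also have "\<dots> \<le> real p * real A" using q by (intro mult_right_mono) auto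
      finally have "real Y \<le> real (p * A)" by simp
      then show ?thesis by (simp only: of_nat_le_iff)
    qed
    let ?X = "{T \<in> L_free_subsets p q N. \<exists>m\<in>T. (2 * p + q) * m \<le> N \<and> card (T \<inter> {1..A}) \<le> R}"
    let ?P = "{m \<in> {1..N}. (2 * p + q) * m \<le> N}"
    have "real (card ?X) \<le> real (card ?P) * (real (N + 1) ^ R * (2 ^ (N - A) * (3 / 4) ^ (Y - A)))"
    proof (rule card_Union_bound)
      show "real (card {T \<in> L_free_subsets p q N. m \<in> T \<and> card (T \<inter> {1..A}) \<le> R})
         \<le> real (N + 1) ^ R * (2 ^ (N - A) * (3 / 4) ^ (Y - A))" if "m \<in> ?P" for m
        unfolding Y_def using that q YA AN
        by (intro card_sparse_small_element_le) (auto simp: Y_def)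
      show "?X \<subseteq> (\<Union>m\<in>?P. {T \<in> L_free_subsets p q N. m \<in> T \<and> card (T \<inter> {1..A}) \<le> R})"
        unfolding L_free_subsets_def by blast
    qed simp_all
    also have "\<dots> \<le> real (N + 1) * (real (N + 1) ^ R * (2 ^ (N - A) * (3 / 4) ^ (Y - A)))"
    proof (rule mult_right_mono)
      have "card ?P \<le> card {1..N}" by (intro card_mono) auto
      then show "real (card ?P) \<le> real (N + 1)" by simp
    qed simp
    also have "\<dots> = real (N + 1) ^ (R + 1) * (2 ^ (N - A) * (3 / 4) ^ (Y - A))" by simp
    also have "\<dots> \<le> real (N + 1) ^ (R + 1) *
        (2 powr (real N - real N / k + c / 6 * real N + real J) * 2 powr (- (2 / 5) * (c * real N - 1)))"
    proof (intro mult_left_mono mult_mono)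
      have "(2::real) ^ (N - A) = 2 powr (real N - real A)" using AN by (simp add: of_nat_diff flip: powr_realpow)
      also have "\<dots> \<le> 2 powr (real N - real N / k + c / 6 * real N + real J)"
        using A_ge by (intro powr_mono) auto
      finally show "(2::real) ^ (N - A) \<le> 2 powr (real N - real N / k + c / 6 * real N + real J)" .
      have "c * real N = real (2 * N) / a - real N / k" unfolding ac[symmetric] by (simp add: left_diff_distrib)
      then have "c * real N - 1 \<le> real (Y - A)" using Y2 A_le by linarith
      then show "(3 / 4 :: real) ^ (Y - A) \<le> 2 powr (- (2 / 5) * (c * real N - 1))"
        by (rule three_quarters_power_le)
    qed simp_all
    also have "\<dots> = real (N + 1) ^ (R + 1) *
        2 powr (real N - real N / k + c / 6 * real N + real J + (- (2 / 5) * (c * real N - 1)))"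
      by (simp only: powr_add)
    also have "\<dots> \<le> real (N + 1) ^ (R + 1) * 2 powr ((real J + 1) + (real N - real N / k - c / 6 * real N))"
    proof (intro mult_left_mono powr_mono)
      have "0 \<le> c * real N" using c by simp
      moreover have "x + z / 6 + y + (- (2 / 5) * (z - 1)) \<le> (y + 1) + (x - z / 6)"
        if "0 \<le> z" for x y z :: real
        using that by (simp add: field_simps)
      ultimately show "real N - real N / k + c / 6 * real N + real J + (- (2 / 5) * (c * real N - 1))
          \<le> (real J + 1) + (real N - real N / k - c / 6 * real N)"
        by (metis times_divide_eq_left)
    qed simp_all
    also have "\<dots> = (2 powr (real J + 1) * real (N + 1) ^ (R + 1)) * 2 powr (real N - real N / k - c / 6 * real N)"
      by (simp only: powr_add mult_ac)
    also have "\<dots> \<le> 2 powr (c / 6 * real N) * 2 powr (real N - real N / k - c / 6 * real N)"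
      using elim(1) by (intro mult_right_mono) auto
    also have "\<dots> = 2 powr (real N - real N / k)" by (simp flip: powr_add)
    finally show ?case by (simp only: A_def w_def k_def)
  qed
qed

text \<open>Stopping \<open>4 * q\<close> blocks short of \<open>N / (p + q)\<close> gains twice the block width in the exponent, which
  beats the loss of one block width in the dense case.\<close>

lemma eventually_card_L_free_subsets_le_const:
  fixes p q :: nat
  assumes q: "1 \<le> q" "q < p" "3 \<le> p" "5 * q \<le> 2 * (p + q)"
  obtains C :: real where "0 \<le> C"
    "\<forall>\<^sub>F N in sequentially. real (card (L_free_subsets p q N)) \<le> C * 2 ^ (N - N div (p + q))"
proof -
  define J where "J = 24 * (2 * p + q)"
  \<comment> \<open>\<open>c * N\<close> is about half a block width, so a net saving of one width
    pays for it.\<close>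
  define c where "c = 1 / (2 * real ((p + q) * J))"
  have J: "1 \<le> J" "4 * q \<le> J" using q by (auto simp: J_def)
  have kJ: "0 < (p + q) * J" using q J by simp
  have c: "0 < c" unfolding c_def using kJ by (simp del: of_nat_mult)
  obtain K where K: "1 \<le> K" and dense: "\<forall>\<^sub>F N in sequentially.
    real (card {T \<in> L_free_subsets p q N.
      \<exists>j<J - 4 * q. K \<le> card (T \<inter> {j * (N div ((p + q) * J)) + 1..j * (N div ((p + q) * J)) + N div ((p + q) * J)})})
    \<le> 2 powr (real N - real N / real (p + q)
         + (1 - (real p - real q) * real (4 * q) / (2 * real q)) * real (N div ((p + q) * J)) + c * real N)"
    by (rule eventually_card_dense_le[OF q(1) less_imp_le[OF q(2)] J c])
  note sparse = eventually_card_small_element_le[OF q(1) q(3) J_def, of "(J - 4 * q) * K"]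
  have large: "\<forall>\<^sub>F N in sequentially. 2 * ((p + q) * J) \<le> N" by (rule eventually_ge_at_top)
  \<comment> \<open>The 3 accounts for \<open>?E\<close>, \<open>?D\<close> and \<open>?S\<close>
    below, the rest for the geometric series in \<open>?L\<close>.\<close>
  define C where "C = 3 + 2 / (1 - sqrt (243 / 256))"
  have "\<forall>\<^sub>F N in sequentially. real (card (L_free_subsets p q N)) \<le> C * 2 ^ (N - N div (p + q))"
    using dense sparse large
  proof eventually_elim
    case (elim N)
    define w where "w = N div ((p + q) * J)"
    define u where "u = N div (p + q)"
    let ?E = "{T \<in> L_free_subsets p q N. T \<subseteq> {u+1..N}}"
    let ?L = "{T \<in> L_free_subsets p q N. \<exists>m\<in>T. T \<subseteq> {m..N} \<and> N < (2 * p + q) * m \<and> m \<le> u}"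
    let ?D = "{T \<in> L_free_subsets p q N. \<exists>j<J - 4 * q. K \<le> card (T \<inter> {j*w+1..j*w+w})}"
    let ?S = "{T \<in> L_free_subsets p q N. \<exists>m\<in>T. (2 * p + q) * m \<le> N
            \<and> card (T \<inter> {1..(J - 4 * q) * w}) \<le> (J - 4 * q) * K}"
    \<comment> \<open>A set outside \<open>?E\<close> and \<open>?D\<close> has its minimum
      \<open>m \<le> u\<close>, and comparing \<open>m\<close> with \<open>N / (2 * p + q)\<close>
      decides between \<open>?L\<close> and \<open>?S\<close>.\<close>
    have "L_free_subsets p q N \<subseteq> (?E \<union> ?L) \<union> (?D \<union> ?S)"
    proof
      fix T assume T: "T \<in> L_free_subsets p q N"
      then have TN: "T \<subseteq> {1..N}" by (simp add: L_free_subsets_def)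
      then have fT: "finite T" using finite_subset by blast
      show "T \<in> (?E \<union> ?L) \<union> (?D \<union> ?S)"
      proof (cases "T \<in> ?E \<or> T \<in> ?D")
        case False
        then have "\<not> T \<subseteq> {u+1..N}" using T by blast
        then obtain x where x: "x \<in> T" "x \<le> u" using TN by fastforce
        define m where "m = Min T"
        have m: "m \<in> T" "T \<subseteq> {m..N}" "m \<le> u"
          using x fT TN order.trans[OF Min_le[OF fT x(1)] x(2)] by (auto simp: m_def intro!: Min_in)
        have "card (T \<inter> {1..(J - 4 * q) * w}) \<le> (J - 4 * q) * K"
          using False T by (intro card_blocks_le) (auto simp: not_le intro: less_imp_le)
        moreover have "N < (2 * p + q) * m \<or> (2 * p + q) * m \<le> N" by linarith
        ultimately show ?thesis using m T by blast
      qed blast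
    qed
    then have "card (L_free_subsets p q N) \<le> card ((?E \<union> ?L) \<union> (?D \<union> ?S))"
      by (intro card_mono) auto
    also have "\<dots> \<le> (card ?E + card ?L) + (card ?D + card ?S)"
      by (rule order.trans[OF card_Un_le add_mono[OF card_Un_le card_Un_le]])
    finally have "real (card (L_free_subsets p q N))
        \<le> real (card ?E) + real (card ?L) + (real (card ?D) + real (card ?S))" by linarith
    moreover have "real (card ?E) \<le> 2 ^ (N - u)"
    proof -
      have "card ?E \<le> card (Pow {u+1..N})" by (intro card_mono) auto
      then have "real (card ?E) \<le> real (card (Pow {u+1..N}))" by (rule of_nat_mono)
      then show ?thesis by (simp add: card_Pow)
    qed
    moreover have "real (card ?L) \<le> 2 / (1 - sqrt (243 / 256)) * 2 ^ (N - u)"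
      unfolding u_def by (rule card_large_min_Union_le[OF q(1) q(4)])
    moreover have pow: "2 powr (real N - real N / real (p + q)) \<le> (2::real) ^ (N - u)"
    proof -
      have "real u \<le> real N / real (p + q)" unfolding u_def using q by (intro real_div_bounds) auto
      moreover have "u \<le> N" by (simp add: u_def)
      ultimately have "2 powr (real N - real N / real (p + q)) \<le> 2 powr real (N - u)"
        by (intro powr_mono) (auto simp: of_nat_diff)
      then show ?thesis by (simp add: powr_realpow)
    qed
    moreover have "real (card ?D) \<le> 2 powr (real N - real N / real (p + q))"
    proof -
      have "real (card ?D) \<le> 2 powr (real N - real N / real (p + q)
         + (1 - (real p - real q) * real (4 * q) / (2 * real q)) * real w + c * real N)"
        using elim(1) by (simp only: w_def)
      also have "\<dots> \<le> 2 powr (real N - real N / real (p + q))"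
      proof (rule powr_mono)
        have "(real p - real q) * real (4 * q) / (2 * real q) = 2 * (real p - real q)" using q by simp
        moreover have "1 \<le> real p - real q" using q by linarith
        ultimately have "(1 - (real p - real q) * real (4 * q) / (2 * real q)) * real w \<le> (- 1) * real w"
          by (intro mult_right_mono) auto
        moreover have "real N / real ((p + q) * J) - 1 < real w"
          unfolding w_def by (rule real_div_bounds[OF kJ])
        moreover have "real N / real ((p + q) * J) = 2 * (c * real N)"
          unfolding c_def using kJ by (simp del: of_nat_mult)
        \<comment> \<open>Absorbs the rounding of \<open>w\<close>, since
          \<open>w > 2 * c * N - 1\<close>.\<close>
        moreover have "1 \<le> c * real N"
        proof -
          define M where "M = real ((p + q) * J)"
          have "0 < M" unfolding M_def using kJ by (simp only: of_nat_0_less_iff)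
          moreover have "2 * M \<le> real N"
            unfolding M_def using of_nat_mono[OF elim(3)] by (simp only: of_nat_mult of_nat_numeral)
          ultimately show ?thesis unfolding c_def M_def[symmetric] by (simp add: field_simps)
        qed
        ultimately show "real N - real N / real (p + q)
         + (1 - (real p - real q) * real (4 * q) / (2 * real q)) * real w + c * real N
           \<le> real N - real N / real (p + q)" by linarith
      qed simp
      finally show ?thesis .
    qed
    moreover have "real (card ?S) \<le> 2 powr (real N - real N / real (p + q))"
      using elim(2) by (simp only: w_def)
    moreover have "C * 2 ^ (N - u) = 3 * 2 ^ (N - u) + 2 / (1 - sqrt (243 / 256)) * 2 ^ (N - u)"
      by (simp only: C_def distrib_right)
    ultimately show ?case unfolding u_def[symmetric] by linarith
  qed
  moreover have "0 \<le> C" by (simp add: C_def)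
  ultimately show ?thesis using that by blast
qed

section \<open>Return from \<open>N\<close> to \<open>n\<close>\<close>

lemma filterlim_diff_div_at_top:
  assumes "1 \<le> q"
  shows "filterlim (\<lambda>n. (n - p) div q :: nat) sequentially sequentially"
  unfolding filterlim_at_top
proof
  fix Z
  show "\<forall>\<^sub>F n in sequentially. Z \<le> (n - p) div q"
    using eventually_ge_at_top[of "p + Z * q"]
  proof eventually_elim
    case (elim n)
    then show ?case using assms by (simp add: less_eq_div_iff_mult_less_eq)
  qed
qed

lemma nat_floor_diff_div: "p \<le> n \<Longrightarrow> nat \<lfloor>(real n - real p) / real q\<rfloor> = (n - p) div q"
  by (metis floor_divide_of_nat_eq nat_int of_nat_diff)

theorem theorem6:
  fixes p q :: nat
  assumes "q \<ge> 1" and "p \<ge> q" and "p \<ge> 2"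
  shows "(\<exists>g :: nat \<Rightarrow> real. g \<in> o(\<lambda>n. real n) \<and>
            (\<forall>n. real (f_max p q n) \<le>
                 2 powr (real (mu_L p q (nat \<lfloor>(real n - real p) / real q\<rfloor>)) + g n)))
       \<and> ((q \<ge> 2 \<and> real p > real q * (3 * real q - 2) / (2 * real q - 2)) \<or> (q = 1 \<and> p \<ge> 3)
            \<longrightarrow> (\<lambda>n. real (f_max p q n))
                  \<in> O(\<lambda>n. 2 ^ mu_L p q (nat \<lfloor>(real n - real p) / real q\<rfloor>)))"
proof (intro conjI impI)
  let ?mu = "\<lambda>n. mu_L p q (nat \<lfloor>(real n - real p) / real q\<rfloor>)"
  define N where "N = (\<lambda>n. (n - p) div q)"
  have lim: "filterlim N sequentially sequentially"
    unfolding N_def by (rule filterlim_diff_div_at_top[OF assms(1)])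
  have large: "\<forall>\<^sub>F n in sequentially. p \<le> n" by (rule eventually_ge_at_top)
  have f: "real (f_max p q n) \<le> real (card (L_free_subsets p q (N n)))" if "p \<le> n" for n
    unfolding N_def using f_max_le[OF assms(1,2) that] by simp
  have mu: "N n - N n div (p + q) \<le> ?mu n" if "p \<le> n" for n
    unfolding nat_floor_diff_div[OF that] N_def using assms by (intro mu_L_ge) simp
  have Nn: "N n \<le> n" for n
    unfolding N_def by (rule order.trans[OF div_le_dividend diff_le_self])
  \<comment> \<open>The excess of the true exponent, cut off at 0: the inequality then holds for
    every \<open>n\<close>, including \<open>n < p\<close>, and only \<open>g \<in> o(n)\<close>
    needs an eventual bound.\<close>
  define g where "g = (\<lambda>n. max 0 (log 2 (real (f_max p q n)) - real (?mu n)))"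
  show "\<exists>g :: nat \<Rightarrow> real. g \<in> o(\<lambda>n. real n) \<and>
            (\<forall>n. real (f_max p q n) \<le> 2 powr (real (?mu n) + g n))"
  proof (intro exI conjI allI)
    show "real (f_max p q n) \<le> 2 powr (real (?mu n) + g n)" for n
    proof (cases "f_max p q n = 0")
      case False
      then have "real (f_max p q n) = 2 powr (log 2 (real (f_max p q n)))" by simp
      also have "\<dots> \<le> 2 powr (real (?mu n) + g n)" unfolding g_def by (intro powr_mono) auto
      finally show ?thesis .
    qed simp
    show "g \<in> o(\<lambda>n. real n)"
    proof (rule landau_o.smallI)
      fix c :: real assume c: "0 < c"
      have "\<forall>\<^sub>F n in sequentially. real (card (L_free_subsets p q (N n)))
           \<le> 2 powr (real (N n) - real (N n) / real (p + q) + c * real (N n))"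
        by (rule eventually_compose_filterlim[OF eventually_card_L_free_subsets_le[OF assms(1,2) c] lim])
      with large show "\<forall>\<^sub>F n in sequentially. norm (g n) \<le> c * norm (real n)"
      proof eventually_elim
        case (elim n)
        have "log 2 (real (f_max p q n)) \<le> real (?mu n) + c * real n"
        proof (cases "f_max p q n = 0")
          case True
          \<comment> \<open>Uses the default value \<open>ln 0 = 0\<close>.\<close>
          then show ?thesis using c by (simp add: log_def)
        next
          case False
          have "real (f_max p q n) \<le> 2 powr (real (N n) - real (N n) / real (p + q) + c * real (N n))"
            using f[OF elim(1)] elim(2) by (rule order.trans)
          then have "log 2 (real (f_max p q n)) \<le> real (N n) - real (N n) / real (p + q) + c * real (N n)"
            using False by (simp add: log_le_iff)
          moreover have "real (N n) - real (N n div (p + q)) \<le> real (?mu n)"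
            using mu[OF elim(1)] by linarith
          moreover have "real (N n div (p + q)) \<le> real (N n) / real (p + q)"
            using assms by (intro real_div_bounds) simp
          moreover have "c * real (N n) \<le> c * real n" using c Nn by simp
          ultimately show ?thesis by linarith
        qed
        moreover have "0 \<le> c * real n" using c by simp
        ultimately show ?case unfolding g_def by simp
      qed
    qed
  qed
  assume *: "(q \<ge> 2 \<and> real p > real q * (3 * real q - 2) / (2 * real q - 2)) \<or> (q = 1 \<and> p \<ge> 3)"
  \<comment> \<open>For \<open>q \<ge> 2\<close>,
    \<open>q * (3 * q - 2) \<ge> 3 * q * (q - 1)\<close> weakens the hypothesis to
    \<open>p > 3 * q / 2\<close>. This gives \<open>(p + q) / q \<ge> 5 / 2\<close>, the edge
    density behind \<open>card_large_min_le\<close>.\<close>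
  have pq: "3 \<le> p \<and> 3 * q < 2 * p"
    using *
  proof
    assume a: "q \<ge> 2 \<and> real p > real q * (3 * real q - 2) / (2 * real q - 2)"
    then have "real q * (3 * real q - 2) < real p * (2 * real q - 2)"
      using pos_divide_less_eq[of "2 * real q - 2"] by simp
    moreover have "3 * real q * (real q - 1) \<le> real q * (3 * real q - 2)" by (simp add: algebra_simps)
    ultimately have "3 * real q * (real q - 1) < 2 * real p * (real q - 1)" by (simp add: algebra_simps)
    then have "3 * real q < 2 * real p" using a by (subst (asm) mult_less_cancel_right_pos) auto
    then have "3 * q < 2 * p" by linarith
    with a show ?thesis by linarith
  qed simp
  then have cond: "q < p" "3 \<le> p" "5 * q \<le> 2 * (p + q)" by (auto simp: distrib_left)
  obtain C :: real where C: "0 \<le> C" and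
    ev: "\<forall>\<^sub>F N in sequentially. real (card (L_free_subsets p q N)) \<le> C * 2 ^ (N - N div (p + q))"
    using eventually_card_L_free_subsets_le_const[OF assms(1) cond] .
  have "\<forall>\<^sub>F n in sequentially. real (card (L_free_subsets p q (N n))) \<le> C * 2 ^ (N n - N n div (p + q))"
    by (rule eventually_compose_filterlim[OF ev lim])
  with large have "\<forall>\<^sub>F n in sequentially. norm (real (f_max p q n)) \<le> C * norm ((2::real) ^ ?mu n)"
  proof eventually_elim
    case (elim n)
    have "real (f_max p q n) \<le> C * 2 ^ (N n - N n div (p + q))"
      using f[OF elim(1)] elim(2) by (rule order.trans)
    also have "\<dots> \<le> C * 2 ^ ?mu n"
      using C mu[OF elim(1)] by (intro mult_left_mono power_increasing) auto
    finally show ?case by simp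
  qed
  then show "(\<lambda>n. real (f_max p q n)) \<in> O(\<lambda>n. 2 ^ ?mu n)" by (rule bigoI)
qed

end
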